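(* For every ai-semiring $S$, the following conditions are equivalent: (i) every Zimin word is minimal for $S$; (ii) $\mathcal F_\infty\in\mathsf V(S)$. Moreover, $\mathsf V(\mathcal F_\infty)$ is locally finite and inherently nonfinitely based, and the six-element Brandt ai-semiring $\mathcal B_2^1$ satisfies $\mathcal B_2^1\notin\mathsf V(\mathcal F_\infty)$.
   Context: An ai-semiring is an algebra $(S,+,\cdot)$ with two binary operations and no designated constants, such that $(S,+)$ is a commutative idempotent semigroup, $(S,\cdot)$ is a semigroup, and $\cdot$ distributes over $+$ on both sides. All varieties are in the signature $\{+,\cdot\}$; $\mathsf V(S)$ is the variety generated by $S$. Zimin words: $Z_1=x_1$, $Z_{m+1}=Z_mx_{m+1}Z_m$ ($m\ge1$). A nonempty word $\mathbf v$ is minimal for $S$ if, for every nonempty word $\mathbf u$ over the countably infinite alphabet of variables, $S\models \mathbf u+\mathbf v\approx\mathbf v$ implies $\mathbf u=\mathbf v$ literally. Flat factor semirings: for a set $L\subseteq A^+$ of nonempty words containing every nonempty (contiguous) factor of each of its words, $F(L)$ is the algebra on $L\cup\{0\}$ with $p\cdot q=pq$ (concatenation) if $p,q\in L$ and $pq\in L$, and $p\cdot q=0$ otherwise; $p+p=p$ and $p+q=0$ if $p\ne q$. Let $Z_\infty$ be the right-infinite word having all $Z_m$ as prefixes, $L_\infty$ the set of its nonempty finite factors, and $\mathcal F_\infty=F(L_\infty)$. $\mathcal B_2^1=\{0,1,c,d,cd,dc\}$: the multiplication is that of the monoid with zero $\langle c,d,1,0\mid cdc=c,\ dcd=d,\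 c^2=d^2=0\rangle$, and addition is idempotent and commutative with $1+cd=cd$, $1+dc=dc$, and every other sum of two distinct elements equal to $0$. A variety is locally finite if all finitely generated members are finite, and finitely based if it is axiomatized by finitely many identities. A locally finite variety is inherently nonfinitely based if it is contained in no finitely based locally finite variety of the same signature. *)

theory Defs
  imports "HOL-Library.FuncSet" "HOL-Library.Infinite_Typeclass"
begin

section \<open>Algebras with two binary operations\<close>

record 'a alg =
  carrier :: "'a set"
  add :: "'a \<Rightarrow> 'a \<Rightarrow> 'a"
  mul :: "'a \<Rightarrow> 'a \<Rightarrow> 'a"

definition algebra :: "'a alg \<Rightarrow> bool" where
  "algebra A \<longleftrightarrow> carrier A \<noteq> {} \<and>
     (\<forall>x\<in>carrier A. \<forall>y\<in>carrier A. add A x y \<in> carrier A \<and> mul A x y \<in> carrier A)"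

definition ai_semiring :: "'a alg \<Rightarrow> bool" where
  "ai_semiring S \<longleftrightarrow> algebra S \<and>
     (\<forall>x\<in>carrier S. add S x x = x) \<and>
     (\<forall>x\<in>carrier S. \<forall>y\<in>carrier S. add S x y = add S y x) \<and>
     (\<forall>x\<in>carrier S. \<forall>y\<in>carrier S. \<forall>z\<in>carrier S.
        add S (add S x y) z = add S x (add S y z) \<and>
        mul S (mul S x y) z = mul S x (mul S y z) \<and>
        mul S x (add S y z) = add S (mul S x y) (mul S x z) \<and>
        mul S (add S x y) z = add S (mul S x z) (mul S y z))"

definition subuniverse :: "'a alg \<Rightarrow> 'a set \<Rightarrow> bool" where
  "subuniverse A B \<longleftrightarrow> B \<subseteq> carrier A \<and>
     (\<forall>x\<in>B. \<forall>y\<in>B. add A x y \<in> B \<and> mul A x y \<in> B)"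

definition generated :: "'a alg \<Rightarrow> 'a set \<Rightarrow> 'a set" where
  "generated A X = \<Inter>{B. subuniverse A B \<and> X \<subseteq> B}"

definition finitely_generated :: "'a alg \<Rightarrow> bool" where
  "finitely_generated A \<longleftrightarrow>
     (\<exists>X. finite X \<and> X \<subseteq> carrier A \<and> generated A X = carrier A)"

section \<open>Identities and varieties\<close>

datatype 'v trm = Var 'v | Add "'v trm" "'v trm" | Mul "'v trm" "'v trm"

type_synonym identity = "nat trm \<times> nat trm"

primrec eval :: "'a alg \<Rightarrow> ('v \<Rightarrow> 'a) \<Rightarrow> 'v trm \<Rightarrow> 'a" where
  "eval A h (Var x) = h x"
| "eval A h (Add s t) = add A (eval A h s) (eval A h t)"
| "eval A h (Mul s t) = mul A (eval A h s) (eval A h t)"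

definition satisfies :: "'a alg \<Rightarrow> identity \<Rightarrow> bool" where
  "satisfies A e \<longleftrightarrow>
     (\<forall>h. range h \<subseteq> carrier A \<longrightarrow> eval A h (fst e) = eval A h (snd e))"

text \<open>
  A variety is the class of all models of a set of identities, in the signature with the two
  binary operations.  A class of algebras is represented by its members whose elements are
  drawn from a universe type \<open>'u\<close>.  The signature is countable, so a finitely generated algebra
  is countable and has an isomorphic copy in every infinite \<open>'u\<close>; likewise every identity that
  fails in some algebra fails in a countable subalgebra.  Hence inclusion between varieties,
  finite axiomatizability and local finiteness do not depend on the choice of an infinite \<open>'u\<close>.
\<close>

definition models :: "identity set \<Rightarrow> 'u alg set" where
  "models E = {A. algebra A \<and> (\<forall>e\<in>E. satisfies A e)}"

definition variety :: "'u alg set \<Rightarrow> bool" where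
  "variety V \<longleftrightarrow> (\<exists>E. V = models E)"

text \<open>
  The least variety containing \<open>S\<close>: the intersection of all varieties that contain \<open>S\<close>.  The
  type of \<open>S\<close> and the universe of the members may differ.  That this class consists of the
  homomorphic images of subalgebras of powers of \<open>S\<close> is shown at the end of the theory.
\<close>

definition variety_of :: "'s alg \<Rightarrow> 'u alg set" where
  "variety_of S = \<Inter>{models E | E. S \<in> models E}"

definition locally_finite :: "'u alg set \<Rightarrow> bool" where
  "locally_finite V \<longleftrightarrow> (\<forall>A\<in>V. finitely_generated A \<longrightarrow> finite (carrier A))"

definition finitely_based :: "'u alg set \<Rightarrow> bool" where
  "finitely_based V \<longleftrightarrow> (\<exists>E. finite E \<and> V = models E)"

definition inherently_nonfinitely_based :: "'u alg set \<Rightarrow> bool" where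
  "inherently_nonfinitely_based V \<longleftrightarrow> variety V \<and> locally_finite V \<and>
     \<not> (\<exists>W. variety W \<and> finitely_based W \<and> locally_finite W \<and> V \<subseteq> W)"

section \<open>Words\<close>

fun word_term :: "'v list \<Rightarrow> 'v trm" where
  "word_term [x] = Var x"
| "word_term (x # y # w) = Mul (Var x) (word_term (y # w))"

definition minimal_for :: "nat list \<Rightarrow> 'a alg \<Rightarrow> bool" where
  "minimal_for v S \<longleftrightarrow> v \<noteq> [] \<and>
     (\<forall>u. u \<noteq> [] \<longrightarrow>
        satisfies S (Add (word_term u) (word_term v), word_term v) \<longrightarrow> u = v)"

text \<open>The variable \<open>x\<^sub>i\<close> is the number \<open>i\<close>.  The empty word at \<open>0\<close> makes \<open>zimin 1 = [1]\<close>.\<close>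

primrec zimin :: "nat \<Rightarrow> nat list" where
  "zimin 0 = []"
| "zimin (Suc m) = zimin m @ Suc m # zimin m"

text \<open>
  Position \<open>n\<close> of the infinite word is read off from a Zimin word that is long enough,
  \<open>zimin (Suc n)\<close> having length \<open>2 ^ Suc n - 1 > n\<close>; see \<open>zimin_prefix\<close> below.
\<close>

definition zimin_inf :: "nat \<Rightarrow> nat" where
  "zimin_inf n = zimin (Suc n) ! n"

definition L_inf :: "nat list set" where
  "L_inf = {map zimin_inf [i..<j] | i j. i < j}"

section \<open>The semirings\<close>

text \<open>The element \<open>0\<close> is \<open>None\<close>.\<close>

definition flat :: "'x list set \<Rightarrow> 'x list option alg" where
  "flat L = \<lparr>
     carrier = insert None (Some ` L),
     add = (\<lambda>a b. if a = b then a else None),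
     mul = (\<lambda>a b. case (a, b) of
              (Some p, Some q) \<Rightarrow>
                 if p \<in> L \<and> q \<in> L \<and> p @ q \<in> L then Some (p @ q) else None
            | _ \<Rightarrow> None)\<rparr>"

definition F_inf :: "nat list option alg" where
  "F_inf = flat L_inf"

datatype brandt = B0 | B1 | Bc | Bd | Bcd | Bdc

fun brandt_mul :: "brandt \<Rightarrow> brandt \<Rightarrow> brandt" where
  "brandt_mul B1 y = y"
| "brandt_mul x B1 = x"
| "brandt_mul Bc Bd = Bcd"
| "brandt_mul Bc Bdc = Bc"
| "brandt_mul Bd Bc = Bdc"
| "brandt_mul Bd Bcd = Bd"
| "brandt_mul Bcd Bc = Bc"
| "brandt_mul Bcd Bcd = Bcd"
| "brandt_mul Bdc Bd = Bd"
| "brandt_mul Bdc Bdc = Bdc"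
| "brandt_mul _ _ = B0"

definition brandt_add :: "brandt \<Rightarrow> brandt \<Rightarrow> brandt" where
  "brandt_add x y =
     (if x = y then x
      else if {x, y} = {B1, Bcd} then Bcd
      else if {x, y} = {B1, Bdc} then Bdc
      else B0)"

definition brandt_semiring :: "brandt alg" where
  "brandt_semiring = \<lparr>carrier = UNIV, add = brandt_add, mul = brandt_mul\<rparr>"

section \<open>Consistency of the definitions\<close>

lemma length_zimin: "length (zimin m) = 2 ^ m - 1"
  by (induction m) auto

lemma zimin_nth_mono:
  assumes "m \<le> k" "n < length (zimin m)"
  shows "zimin k ! n = zimin m ! n"
  using assms
proof (induction k rule: dec_induct)
  case (step k)
  have "2 ^ m \<le> (2 ^ k :: nat)" using step.hyps by simp
  then have "n < length (zimin k)" using step.prems unfolding length_zimin by linarith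
  then show ?case using step by (simp add: nth_append)
qed simp

lemma zimin_prefix: "map zimin_inf [0..<length (zimin m)] = zimin m"
proof (rule nth_equalityI)
  fix n assume "n < length (map zimin_inf [0..<length (zimin m)])"
  then have n: "n < length (zimin m)" by simp
  have "Suc n < 2 ^ Suc n" by (rule less_exp)
  then have n': "n < length (zimin (Suc n))" unfolding length_zimin by linarith
  have "zimin (Suc n) ! n = zimin m ! n"
  proof (cases "m \<le> Suc n")
    case True then show ?thesis by (rule zimin_nth_mono[OF _ n])
  next
    case False
    then have "Suc n \<le> m" by simp
    then show ?thesis using zimin_nth_mono[OF _ n'] by metis
  qed
  then show "map zimin_inf [0..<length (zimin m)] ! n = zimin m ! n"
    using n by (simp add: zimin_inf_def)
qed simp

lemma L_inf_nonempty: "[] \<notin> L_inf"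
  by (auto simp: L_inf_def)

lemma L_inf_factor:
  assumes "p @ w @ q \<in> L_inf" "w \<noteq> []"
  shows "w \<in> L_inf"
proof -
  from assms(1) obtain i j where e: "p @ w @ q = map zimin_inf [i..<j]"
    by (auto simp: L_inf_def)
  let ?k = "i + length p"
  have "length p + length w + length q = j - i"
    using arg_cong[OF e, of length] by simp
  moreover have "length w > 0" using assms(2) by simp
  ultimately have l: "?k + length w \<le> j" "i < j" by linarith+
  have "w = take (length w) (drop (length p) (p @ w @ q))" by simp
  also have "\<dots> = map zimin_inf (take (length w) [?k..<j])"
    unfolding e by (simp add: take_map drop_map)
  also have "\<dots> = map zimin_inf [?k..<?k + length w]"
    using l by (simp add: take_upt)
  finally have "w = map zimin_inf [?k..<?k + length w]" .
  moreover have "?k < ?k + length w" using assms(2) by simp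
  ultimately show ?thesis unfolding L_inf_def by blast
qed

lemma ai_semiring_flat:
  assumes closed: "\<And>p w q. p @ w @ q \<in> L \<Longrightarrow> w \<noteq> [] \<Longrightarrow> w \<in> L" and ne: "[] \<notin> L"
  shows "ai_semiring (flat L)"
proof -
  have pre: "p \<in> L" if "p @ q \<in> L" "p \<noteq> []" for p q
    using closed[of "[]" p q] that by simp
  have suf: "q \<in> L" if "p @ q \<in> L" "q \<noteq> []" for p q
    using closed[of p q "[]"] that by simp
  have fac: "p @ q \<in> L" "q @ r \<in> L" if "p @ q @ r \<in> L" "p \<in> L" "r \<in> L" for p q r
    using pre[of "p @ q" r] suf[of p "q @ r"] that ne by auto
  let ?M = "mul (flat L)" and ?A = "add (flat L)"
  have A: "?A x y = (if x = y then x else None)" for x y by (simp add: flat_def)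
  have M0: "?M x None = None" "?M None x = None" for x
    by (simp_all add: flat_def split: option.split)
  have M: "?M (Some p) (Some q) = (if p @ q \<in> L then Some (p @ q) else None)"
    if "p \<in> L" "q \<in> L" for p q
    using that by (simp add: flat_def)
  have closed: "x = None \<or> (\<exists>p\<in>L. x = Some p)" if "x \<in> carrier (flat L)" for x
    using that by (auto simp: flat_def)
  have cl: "?A x y \<in> carrier (flat L)" "?M x y \<in> carrier (flat L)"
    if "x \<in> carrier (flat L)" "y \<in> carrier (flat L)" for x y
    using that by (auto simp: flat_def split: option.split)
  have assoc: "?M (?M x y) z = ?M x (?M y z)"
    if x: "x \<in> carrier (flat L)" and y: "y \<in> carrier (flat L)" and z: "z \<in> carrier (flat L)" for x y z
  proof -
    have "?M (?M (Some p) (Some q)) (Some r) = ?M (Some p) (?M (Some q) (Some r))"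
      if "p \<in> L" "q \<in> L" "r \<in> L" for p q r
    proof (cases "p @ q @ r \<in> L")
      case True
      then show ?thesis using that fac[OF True] by (simp add: M)
    next
      case False
      then show ?thesis using that by (cases "p @ q \<in> L"; cases "q @ r \<in> L"; simp add: M M0)
    qed
    then show ?thesis using closed[OF x] closed[OF y] closed[OF z] by (auto simp: M0)
  qed
  have dl: "?M x (?A y z) = ?A (?M x y) (?M x z)" "?M (?A y z) x = ?A (?M y x) (?M z x)"
    if x: "x \<in> carrier (flat L)" and y: "y \<in> carrier (flat L)" and z: "z \<in> carrier (flat L)" for x y z
    using closed[OF x] closed[OF y] closed[OF z] by (elim disjE bexE; simp add: A M M0)+
  have ne': "carrier (flat L) \<noteq> {}" by (simp add: flat_def)
  have aci: "?A (?A x y) z = ?A x (?A y z)" "?A x y = ?A y x" "?A x x = x" for x y z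
    by (simp_all add: A)
  show ?thesis
    unfolding ai_semiring_def algebra_def
    by (intro conjI ballI) (rule ne' cl assoc dl aci; assumption)+
qed

lemma ai_semiring_F_inf: "ai_semiring F_inf"
  unfolding F_inf_def using L_inf_factor L_inf_nonempty by (rule ai_semiring_flat)

lemma ai_semiring_brandt: "ai_semiring brandt_semiring"
proof -
  have add: "brandt_add x x = x" "brandt_add x y = brandt_add y x"
      "brandt_add (brandt_add x y) z = brandt_add x (brandt_add y z)" for x y z
    by (cases x; cases y; cases z; simp add: brandt_add_def doubleton_eq_iff)+
  have mul: "brandt_mul (brandt_mul x y) z = brandt_mul x (brandt_mul y z)"
      "brandt_mul x (brandt_add y z) = brandt_add (brandt_mul x y) (brandt_mul x z)"
      "brandt_mul (brandt_add x y) z = brandt_add (brandt_mul x z) (brandt_mul y z)" for x y z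
    by (cases x; cases y; cases z; simp add: brandt_add_def doubleton_eq_iff)+
  show ?thesis
    unfolding ai_semiring_def algebra_def brandt_semiring_def by (simp add: add(1) add(3) mul) (metis add(2))
qed

lemma brandt_presentation:
  "brandt_mul Bc Bd = Bcd" "brandt_mul Bd Bc = Bdc"
  "brandt_mul (brandt_mul Bc Bd) Bc = Bc" "brandt_mul (brandt_mul Bd Bc) Bd = Bd"
  "brandt_mul Bc Bc = B0" "brandt_mul Bd Bd = B0"
  "brandt_mul B0 x = B0" "brandt_mul x B0 = B0"
  "brandt_mul B1 x = x" "brandt_mul x B1 = x"
  by (simp_all, (cases x; simp)+)

subsection \<open>The generated variety consists of images of subalgebras of powers\<close>

definition power_alg :: "'i set \<Rightarrow> 's alg \<Rightarrow> ('i \<Rightarrow> 's) alg" where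
  "power_alg I S = \<lparr>
     carrier = (\<Pi>\<^sub>E i\<in>I. carrier S),
     add = (\<lambda>f g. \<lambda>i\<in>I. add S (f i) (g i)),
     mul = (\<lambda>f g. \<lambda>i\<in>I. mul S (f i) (g i))\<rparr>"

definition hom_onto :: "('a \<Rightarrow> 'b) \<Rightarrow> 'a alg \<Rightarrow> 'a set \<Rightarrow> 'b alg \<Rightarrow> bool" where
  "hom_onto f P B A \<longleftrightarrow> f ` B = carrier A \<and>
     (\<forall>x\<in>B. \<forall>y\<in>B. f (add P x y) = add A (f x) (f y) \<and> f (mul P x y) = mul A (f x) (f y))"

lemma mem_variety_of_iff:
  assumes "algebra S"
  shows "A \<in> variety_of S \<longleftrightarrow> algebra A \<and> (\<forall>e. satisfies S e \<longrightarrow> satisfies A e)"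
proof
  assume A: "A \<in> variety_of S"
  have "S \<in> models {e. satisfies S e}" using assms by (simp add: models_def)
  then have "A \<in> models {e. satisfies S e}" using A unfolding variety_of_def by blast
  then show "algebra A \<and> (\<forall>e. satisfies S e \<longrightarrow> satisfies A e)" by (simp add: models_def)
qed (auto simp: variety_of_def models_def)

lemma variety_variety_of:
  assumes "algebra S"
  shows "variety (variety_of S)"
proof -
  have "variety_of S = models {e. satisfies S e}"
    using mem_variety_of_iff[OF assms] by (auto simp: models_def)
  then show ?thesis unfolding variety_def by blast
qed

lemma eval_cong: "(\<And>x. x \<in> set_trm t \<Longrightarrow> h x = k x) \<Longrightarrow> eval A h t = eval A k t"
  by (induction t) auto

lemma eval_map: "eval A h (map_trm f t) = eval A (h \<circ> f) t"
  by (induction t) auto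

lemma eval_closed: "algebra A \<Longrightarrow> (\<And>x. h x \<in> carrier A) \<Longrightarrow> eval A h t \<in> carrier A"
  by (induction t) (auto simp: algebra_def)

lemma satisfies_any_variables:
  fixes s t :: "'v trm"
  assumes A: "algebra A" and SA: "\<And>e. satisfies S e \<Longrightarrow> satisfies A e"
    and st: "\<And>h. range h \<subseteq> carrier S \<Longrightarrow> eval S h s = eval S h t"
    and k: "range k \<subseteq> carrier A"
  shows "eval A k s = eval A k t"
proof -
  let ?X = "set_trm s \<union> set_trm t"
  have "finite (set_trm r)" for r :: "'v trm" by (induction r) auto
  then have "finite ?X" by simp
  then obtain f :: "'v \<Rightarrow> nat" where f: "inj_on f ?X"
    using finite_imp_inj_to_nat_seg by blast
  define g where "g n = (if n \<in> f ` ?X then inv_into ?X f n else undefined)" for n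
  have gf: "g (f x) = x" if "x \<in> ?X" for x
    using f that unfolding g_def by simp
  have "satisfies S (map_trm f s, map_trm f t)"
    unfolding satisfies_def
  proof (intro allI impI)
    fix h :: "nat \<Rightarrow> _" assume "range h \<subseteq> carrier S"
    then have "range (h \<circ> f) \<subseteq> carrier S" by auto
    from st[OF this]
    show "eval S h (fst (map_trm f s, map_trm f t)) = eval S h (snd (map_trm f s, map_trm f t))"
      by (simp add: eval_map)
  qed
  then have "satisfies A (map_trm f s, map_trm f t)" by (rule SA)
  moreover have "range (k \<circ> g) \<subseteq> carrier A" using k by auto
  ultimately have "eval A (k \<circ> g \<circ> f) s = eval A (k \<circ> g \<circ> f) t"
    unfolding satisfies_def by (simp add: eval_map)
  moreover have "eval A (k \<circ> g \<circ> f) s = eval A k s" "eval A (k \<circ> g \<circ> f) t = eval A k t"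
    by (rule eval_cong; simp add: gf)+
  ultimately show ?thesis by simp
qed

lemma image_imp_satisfies:
  assumes B: "subuniverse (power_alg I S) B" and f: "hom_onto f (power_alg I S) B A"
    and e: "satisfies S e"
  shows "satisfies A e"
  unfolding satisfies_def
proof (intro allI impI)
  fix h :: "nat \<Rightarrow> _" assume h: "range h \<subseteq> carrier A"
  have "f ` B = carrier A" using f by (simp add: hom_onto_def)
  then have "h n \<in> f ` B" for n using h by auto
  then have k: "inv_into B f (h n) \<in> B" "f (inv_into B f (h n)) = h n" for n
    by (simp_all add: inv_into_into f_inv_into_f)
  define k where "k n = inv_into B f (h n)" for n
  note k = k[folded k_def]
  let ?P = "power_alg I S"
  have *: "eval ?P k t \<in> B \<and> f (eval ?P k t) = eval A h t" for t
    using B f k by (induction t) (auto simp: subuniverse_def hom_onto_def)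
  have BP: "B \<subseteq> (\<Pi>\<^sub>E i\<in>I. carrier S)" using B by (simp add: subuniverse_def power_alg_def)
  have pw: "eval ?P k t i = eval S (\<lambda>n. k n i) t" if "i \<in> I" for t i
    using that by (induction t) (auto simp: power_alg_def)
  have "eval ?P k (fst e) = eval ?P k (snd e)"
  proof (rule PiE_ext)
    show "eval ?P k (fst e) \<in> (\<Pi>\<^sub>E i\<in>I. carrier S)" "eval ?P k (snd e) \<in> (\<Pi>\<^sub>E i\<in>I. carrier S)"
      using * BP by blast+
    fix i assume i: "i \<in> I"
    have "range (\<lambda>n. k n i) \<subseteq> carrier S" using k(1) BP i by (auto simp: PiE_iff)
    then show "eval ?P k (fst e) i = eval ?P k (snd e) i"
      using e i by (simp add: pw satisfies_def)
  qed
  then show "eval A h (fst e) = eval A h (snd e)" using * by metis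
qed

lemma satisfies_imp_image:
  fixes A :: "'b alg" and S :: "'s alg"
  assumes S: "algebra S" and A: "algebra A" and SA: "\<And>e. satisfies S e \<Longrightarrow> satisfies A e"
  shows "\<exists>(I :: ('b \<Rightarrow> 's) set) B f. subuniverse (power_alg I S) B \<and> hom_onto f (power_alg I S) B A"
proof -
  define I :: "('b \<Rightarrow> 's) set" where "I = {h. range h \<subseteq> carrier S}"
  obtain a where a: "a \<in> carrier A" using A by (auto simp: algebra_def)
  define k where "k x = (if x \<in> carrier A then x else a)" for x
  have k: "range k \<subseteq> carrier A" using a by (auto simp: k_def)
  define P where "P = power_alg I S"
  define T where "T t = (\<lambda>h\<in>I. eval S h t)" for t :: "'b trm"
  define f where "f b = eval A k (SOME t. T t = b)" for b
  have T_eq: "eval A k s = eval A k t" if "T s = T t" for s t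
  proof (rule satisfies_any_variables[OF A SA _ k])
    fix h :: "'b \<Rightarrow> 's" assume "range h \<subseteq> carrier S"
    then have "h \<in> I" by (simp add: I_def)
    then show "eval S h s = eval S h t" using fun_cong[OF that, of h] by (simp add: T_def)
  qed
  have fT: "f (T t) = eval A k t" for t
    unfolding f_def by (rule T_eq) (rule someI[of "\<lambda>s. T s = T t" t], simp)
  have T_add: "add P (T s) (T t) = T (Add s t)" and T_mul: "mul P (T s) (T t) = T (Mul s t)" for s t
    by (auto simp: P_def power_alg_def T_def)
  have "T t \<in> carrier P" for t
    unfolding P_def power_alg_def T_def by (auto simp: I_def intro!: eval_closed[OF S])
  then have "subuniverse P (range T)"
    by (auto simp: subuniverse_def T_add T_mul)
  moreover have "f ` range T = carrier A"
  proof
    show "f ` range T \<subseteq> carrier A" 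
      using eval_closed[OF A, of k] k by (auto simp: fT image_subset_iff)
    show "carrier A \<subseteq> f ` range T"
    proof
      fix x assume "x \<in> carrier A"
      then have "x = f (T (Var x))" by (simp add: fT k_def)
      then show "x \<in> f ` range T" by blast
    qed
  qed
  then have "hom_onto f P (range T) A"
    by (auto simp: hom_onto_def T_add T_mul fT)
  ultimately show ?thesis unfolding P_def by blast
qed

theorem variety_of_HSP:
  fixes A :: "'b alg" and S :: "'s alg"
  assumes "algebra S"
  shows "A \<in> variety_of S \<longleftrightarrow> algebra A \<and>
    (\<exists>(I :: ('b \<Rightarrow> 's) set) B f. subuniverse (power_alg I S) B \<and> hom_onto f (power_alg I S) B A)"
proof
  assume "A \<in> variety_of S"
  then have "algebra A" and *: "\<And>e. satisfies S e \<Longrightarrow> satisfies A e"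
    unfolding mem_variety_of_iff[OF assms] by blast+
  with satisfies_imp_image[OF assms, of A]
  show "algebra A \<and>
    (\<exists>(I :: ('b \<Rightarrow> 's) set) B f. subuniverse (power_alg I S) B \<and> hom_onto f (power_alg I S) B A)"
    by simp
next
  assume "algebra A \<and>
    (\<exists>(I :: ('b \<Rightarrow> 's) set) B f. subuniverse (power_alg I S) B \<and> hom_onto f (power_alg I S) B A)"
  then obtain I :: "('b \<Rightarrow> 's) set" and B f where "algebra A"
    and B: "subuniverse (power_alg I S) B" and f: "hom_onto f (power_alg I S) B A"
    by auto
  then show "A \<in> variety_of S"
    using image_imp_satisfies[OF B f] by (simp add: mem_variety_of_iff[OF assms])
qed

end

theory Submission
  imports Defs "HOL-Library.Countable"
begin

text \<open>
  The value of a term in a flat semiring is a word \<open>w\<close> iff all words of the term are mapped to \<open>w\<close>.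
  Hence an identity of \<open>S\<close> that fails in \<open>\<F>\<^sub>\<infinity>\<close> gives, after substitution and multiplication, an
  identity that contradicts the minimality of some Zimin word.  Every factor of \<open>Z\<^sub>\<infinity>\<close> contains a
  letter that occurs exactly once, so a word in \<open>k\<close> variables with an image in \<open>L\<^sub>\<infinity>\<close> is shorter than
  \<open>2 ^ k\<close>; this gives local finiteness, and \<open>x\<^sup>2 \<approx> y\<^sup>2\<close>, which fails in the Brandt semiring.

  For the inherent nonfinite basis, take identities of \<open>\<F>\<^sub>\<infinity>\<close> in fewer than \<open>r - 2\<close> variables.  They hold
  in the flat factor semiring of an infinite word over a finite alphabet, which is infinite and finitely
  generated.  This word consists of blocks of length \<open>r\<close> that redundantly encode the letters of the same
  word.  Given words with a common image in it, some pair of adjacent columns is never separated by a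
  boundary between variables.  Contracting each block to this pair gives the same situation for a shorter
  factor, and by induction an image in \<open>Z\<^sub>\<infinity>\<close>; then the gaps between the pairs are filled with pieces of
  Zimin words.  The pieces can be chosen so that they reveal the column and the letter at any given column,
  so that a word with the same image as the given ones in \<open>Z\<^sub>\<infinity>\<close> has the same image as well in the word
  over the finite alphabet.
\<close>

section \<open>Terms as finite sets of words\<close>

primrec words :: "'v trm \<Rightarrow> 'v list set" where
  "words (Var x) = {[x]}"
| "words (Add s t) = words s \<union> words t"
| "words (Mul s t) = {u @ v | u v. u \<in> words s \<and> v \<in> words t}"

lemma words_nonempty: "words t \<noteq> {}"
  by (induction t) auto

lemma Nil_notin_words: "[] \<notin> words t"
  by (induction t) auto

lemma set_words: "u \<in> words t \<Longrightarrow> set u \<subseteq> set_trm t"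
  by (induction t arbitrary: u) fastforce+

lemma words_word_term: "w \<noteq> [] \<Longrightarrow> words (word_term w) = {w}"
  by (induction w rule: word_term.induct) auto

lemma finite_set_trm: "finite (set_trm t)"
  by (induction t) auto

lemma concat_map_eq_Nil_iff: "(\<And>x. x \<in> set u \<Longrightarrow> f x \<noteq> []) \<Longrightarrow> concat (map f u) = [] \<longleftrightarrow> u = []"
  by (cases u) auto

section \<open>Evaluation of terms in flat semirings\<close>

lemma mem_carrier_flat: "Some w \<in> carrier (flat L) \<longleftrightarrow> w \<in> L"
  by (auto simp: flat_def)

text \<open>A sum is nonzero only if both summands are the same word. In a product, fixing a word of
  one factor and cancelling its image in the free monoid shows that all words of the other factor
  have a common image.\<close>

lemma eval_flat_eq_Some_iff:
  assumes L: "\<And>p w q. p @ w @ q \<in> L \<Longrightarrow> w \<noteq> [] \<Longrightarrow> w \<in> L" "[] \<notin> L"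
    and h: "range h \<subseteq> carrier (flat L)"
  shows "eval (flat L) h t = Some w \<longleftrightarrow>
    w \<in> L \<and> (\<forall>u\<in>words t. (\<forall>x\<in>set u. h x \<noteq> None) \<and> concat (map (the \<circ> h) u) = w)"
proof (induction t arbitrary: w)
  case (Var x)
  have "h x \<in> carrier (flat L)" using h by auto
  then show ?case by (auto simp: mem_carrier_flat)
next
  case (Add s t)
  have "eval (flat L) h (Add s t) = Some w \<longleftrightarrow>
      eval (flat L) h s = Some w \<and> eval (flat L) h t = Some w"
    by (auto simp: flat_def)
  then show ?case using Add.IH by auto
next
  case (Mul s t)
  let ?e = "eval (flat L) h" and ?c = "\<lambda>u. concat (map (the \<circ> h) u)"
  have hx: "the (h x) \<noteq> []" if "h x \<noteq> None" for x
  proof -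
    have "h x \<in> carrier (flat L)" using h by auto
    then show ?thesis using that L(2) by (auto simp: flat_def)
  qed
  have *: "?e (Mul s t) = Some w \<longleftrightarrow> w \<in> L \<and> (\<exists>p q. p \<in> L \<and> q \<in> L \<and> ?e s = Some p \<and> ?e t = Some q \<and> p @ q = w)"
    by (auto simp: flat_def split: option.splits if_splits)
  show ?case
  proof
    assume "?e (Mul s t) = Some w"
    then obtain p q where pq: "w \<in> L" "?e s = Some p" "?e t = Some q" "p @ q = w" using * by blast
    have s: "\<forall>u\<in>words s. (\<forall>x\<in>set u. h x \<noteq> None) \<and> ?c u = p"
      using pq(2) unfolding Mul.IH by blast
    have t: "\<forall>u\<in>words t. (\<forall>x\<in>set u. h x \<noteq> None) \<and> ?c u = q"
      using pq(3) unfolding Mul.IH by blast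
    show "w \<in> L \<and> (\<forall>u\<in>words (Mul s t). (\<forall>x\<in>set u. h x \<noteq> None) \<and> ?c u = w)"
      using s t pq(1,4) by auto
  next
    assume A: "w \<in> L \<and> (\<forall>u\<in>words (Mul s t). (\<forall>x\<in>set u. h x \<noteq> None) \<and> ?c u = w)"
    obtain u0 v0 where u0: "u0 \<in> words s" and v0: "v0 \<in> words t"
      using words_nonempty by blast
    have B: "(\<forall>x\<in>set u. h x \<noteq> None) \<and> (\<forall>x\<in>set v. h x \<noteq> None) \<and> ?c u @ ?c v = w"
      if "u \<in> words s" "v \<in> words t" for u v
    proof -
      have "u @ v \<in> words (Mul s t)" using that by auto
      then have "(\<forall>x\<in>set (u @ v). h x \<noteq> None) \<and> ?c (u @ v) = w" using A by blast
      then show ?thesis by auto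
    qed
    have "?c u0 \<noteq> []" "?c v0 \<noteq> []"
      using B[OF u0 v0] u0 v0 Nil_notin_words[of s] Nil_notin_words[of t] hx
      by (metis (mono_tags) concat_map_eq_Nil_iff comp_apply)+
    moreover have "?c u0 @ ?c v0 \<in> L" using A B[OF u0 v0] by simp
    ultimately have in_L: "?c u0 \<in> L" "?c v0 \<in> L"
      using L(1)[of "[]" "?c u0" "?c v0"] L(1)[of "?c u0" "?c v0" "[]"] by simp_all
    have "?c u = ?c u0" if "u \<in> words s" for u
      using B[OF that v0] B[OF u0 v0] by (metis append_same_eq)
    then have s: "?e s = Some (?c u0)" unfolding Mul.IH using in_L B v0 by blast
    have "?c v = ?c v0" if "v \<in> words t" for v
      using B[OF u0 that] B[OF u0 v0] by (metis same_append_eq)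
    then have t: "?e t = Some (?c v0)" unfolding Mul.IH using in_L B u0 by blast
    show "?e (Mul s t) = Some w" using * s t in_L B[OF u0 v0] A by blast
  qed
qed

lemma eval_F_inf_eq_Some_iff:
  assumes "range h \<subseteq> carrier F_inf"
  shows "eval F_inf h t = Some w \<longleftrightarrow>
    w \<in> L_inf \<and> (\<forall>u\<in>words t. (\<forall>x\<in>set u. h x \<noteq> None) \<and> concat (map (the \<circ> h) u) = w)"
  using eval_flat_eq_Some_iff[of L_inf h] L_inf_factor L_inf_nonempty assms
  unfolding F_inf_def by blast

lemma algebra_F_inf: "algebra F_inf"
  using ai_semiring_F_inf by (simp add: ai_semiring_def)

lemma satisfies_F_inf_substitution:
  assumes st: "satisfies F_inf (s, t)" and \<psi>: "\<And>x. \<psi> x \<in> L_inf" and w: "w \<in> L_inf"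
    and u: "\<And>u. u \<in> words s \<Longrightarrow> concat (map \<psi> u) = w" and v: "v \<in> words t"
  shows "concat (map \<psi> v) = w"
proof -
  have r: "range (Some \<circ> \<psi>) \<subseteq> carrier F_inf"
    using \<psi> by (auto simp: F_inf_def flat_def)
  have "eval F_inf (Some \<circ> \<psi>) s = Some w"
    unfolding eval_F_inf_eq_Some_iff[OF r] using u w by (simp add: comp_def)
  then have "eval F_inf (Some \<circ> \<psi>) t = Some w"
    using st r by (simp add: satisfies_def)
  then show ?thesis
    unfolding eval_F_inf_eq_Some_iff[OF r] using v by (simp add: comp_def)
qed

text \<open>Two values can differ only if one of them is a word, so it is enough to carry words from
  either side to the other; \<open>{s', t'} = {s, t}\<close> covers both directions at once.\<close>

lemma satisfies_flatI:
  assumes L: "\<And>p w q. p @ w @ q \<in> L \<Longrightarrow> w \<noteq> [] \<Longrightarrow> w \<in> L" "[] \<notin> L"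
    and st: "\<And>h w s' t'. range h \<subseteq> carrier (flat L) \<Longrightarrow> {s', t'} = {s, t} \<Longrightarrow>
      eval (flat L) h s' = Some w \<Longrightarrow> eval (flat L) h t' = Some w"
  shows "satisfies (flat L) (s, t)"
proof -
  have "eval (flat L) h s = eval (flat L) h t" if "range h \<subseteq> carrier (flat L)" for h
    using st[OF that, of s t] st[OF that, of t s]
    by (cases "eval (flat L) h s"; cases "eval (flat L) h t") (auto simp: insert_commute)
  then show ?thesis by (simp add: satisfies_def)
qed

lemma satisfies_sym: "satisfies A (s, t) \<Longrightarrow> satisfies A (t, s)"
  by (simp add: satisfies_def)

section \<open>The infinite Zimin word\<close>

lemma singleton_in_L_inf: "0 < i \<Longrightarrow> [i] \<in> L_inf"
proof -
  assume "0 < i"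
  then obtain k where k: "i = Suc k" by (cases i) auto
  have "zimin k @ [i] @ zimin k = map zimin_inf [0..<length (zimin i)]"
    unfolding zimin_prefix by (simp add: k)
  moreover have "0 < length (zimin i)" by (simp add: k)
  ultimately have "zimin k @ [i] @ zimin k \<in> L_inf" unfolding L_inf_def by blast
  then show ?thesis by (rule L_inf_factor) simp
qed

lemma zimin_in_L_inf: "0 < m \<Longrightarrow> zimin m \<in> L_inf"
proof -
  assume "0 < m"
  then have l: "0 < length (zimin m)" by (cases m) auto
  have "map zimin_inf [0..<length (zimin m)] \<in> L_inf" using l unfolding L_inf_def by blast
  then show ?thesis unfolding zimin_prefix .
qed

lemma set_zimin: "set (zimin m) = {1..m}"
  by (induction m) auto

lemma upt_split3: "i \<le> j \<Longrightarrow> j \<le> k \<Longrightarrow> [0..<k] = [0..<i] @ [i..<j] @ [j..<k]"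
  using upt_add_eq_append[of 0 i "k - i"] upt_add_eq_append[of i j "k - j"] by simp

lemma L_inf_sublist_zimin:
  assumes "w \<in> L_inf"
  obtains m p q where "zimin m = p @ w @ q"
proof -
  from assms obtain i j where w: "w = map zimin_inf [i..<j]" "i < j" by (auto simp: L_inf_def)
  have "j < 2 ^ j" by (rule less_exp)
  then have j: "j \<le> length (zimin j)" unfolding length_zimin by linarith
  have "zimin j = map zimin_inf [0..<length (zimin j)]" unfolding zimin_prefix ..
  also have "\<dots> = map zimin_inf [0..<i] @ w @ map zimin_inf [j..<length (zimin j)]"
    unfolding upt_split3[OF less_imp_le[OF w(2)] j] w(1) by simp
  finally show thesis by (rule that)
qed

text \<open>The middle letter of \<open>zimin (Suc m)\<close> occurs there once. A factor that
  contains it is done, and any other lies within one of the two copies of \<open>zimin m\<close>,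
  where the induction applies.\<close>

lemma L_inf_letter_once:
  assumes "w \<in> L_inf"
  shows "\<exists>k. count_list w k = 1"
proof -
  have "\<exists>k. count_list w k = 1" if "zimin m = p @ w @ q" "w \<noteq> []" for m p w q
    using that
  proof (induction m arbitrary: p q)
    case (Suc m)
    let ?k = "Suc m"
    have nin: "?k \<notin> set (zimin m)" by (simp add: set_zimin)
    have e: "zimin m @ ?k # zimin m = p @ w @ q" using Suc.prems by simp
    have c: "count_list (p @ w @ q) ?k = 1"
      unfolding e[symmetric] using nin by (simp add: count_list_0_iff)
    consider "?k \<in> set p" | "?k \<in> set w" | "?k \<in> set q"
      using arg_cong[OF e, of set] by auto
    then show ?case
    proof cases
      case 1
      then obtain p1 p2 where "p = p1 @ ?k # p2" by (meson split_list)
      then have "zimin m @ ?k # zimin m = p1 @ ?k # (p2 @ w @ q)" using e by simp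
      then have "zimin m = p2 @ w @ q" using append_Cons_eq_iff[OF nin nin] by blast
      then show ?thesis using Suc by blast
    next
      case 2
      then have "count_list w ?k \<noteq> 0" by (simp add: count_list_0_iff)
      then have "count_list w ?k = 1" using c by simp
      then show ?thesis by blast
    next
      case 3
      then obtain q1 q2 where "q = q1 @ ?k # q2" by (meson split_list)
      then have "zimin m @ ?k # zimin m = (p @ w @ q1) @ ?k # q2" using e by simp
      then have "zimin m = p @ w @ q1" using append_Cons_eq_iff[OF nin nin] by blast
      then show ?thesis using Suc by blast
    qed
  qed simp
  moreover obtain m p q where "zimin m = p @ w @ q" using L_inf_sublist_zimin[OF assms] by metis
  moreover have "w \<noteq> []" using assms L_inf_nonempty by blast
  ultimately show ?thesis by blast
qed

text \<open>A letter that occurs once in the image comes from a variable \<open>x\<close> that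
  occurs once in \<open>u\<close>. The parts of \<open>u\<close> before and after \<open>x\<close>
  use one variable less, and by induction each is shorter than \<open>2 ^ k\<close>; with
  \<open>x\<close> the total stays below \<open>2 ^ Suc k\<close>.\<close>

lemma L_inf_image_length:
  assumes "finite Y" "set u \<subseteq> Y" "\<And>x. x \<in> Y \<Longrightarrow> \<phi> x \<noteq> []" "concat (map \<phi> u) \<in> L_inf"
  shows "length u < 2 ^ card Y"
  using assms
proof (induction "card Y" arbitrary: Y u)
  case 0
  then show ?case using L_inf_nonempty by auto
next
  case (Suc k)
  obtain m where m: "count_list (concat (map \<phi> u)) m = 1"
    using L_inf_letter_once[OF Suc.prems(4)] by blast
  then have "m \<in> set (concat (map \<phi> u))" by (metis count_list_0_iff zero_neq_one)
  then obtain x where x: "x \<in> set u" "m \<in> set (\<phi> x)" by auto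
  then obtain u1 u2 where u: "u = u1 @ x # u2" by (meson split_list)
  have "count_list (\<phi> x) m \<noteq> 0" using x by (simp add: count_list_0_iff)
  then have "count_list (concat (map \<phi> u1)) m = 0" "count_list (concat (map \<phi> u2)) m = 0"
    using m by (auto simp: u)
  then have "m \<notin> set (concat (map \<phi> u1))" "m \<notin> set (concat (map \<phi> u2))"
    unfolding count_list_0_iff by blast+
  then have x12: "x \<notin> set u1" "x \<notin> set u2" using x(2) by auto
  have xY: "x \<in> Y" using Suc.prems(2) u by auto
  have card: "k = card (Y - {x})" using Suc.hyps(2) xY Suc.prems(1) by simp
  have part: "length v < 2 ^ k" if "p @ concat (map \<phi> v) @ q \<in> L_inf" "set v \<subseteq> Y - {x}" for p v q
  proof (cases "v = []")
    case False
    have "concat (map \<phi> v) \<noteq> []" using False that(2) Suc.prems(3) by (cases v) auto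
    then have "concat (map \<phi> v) \<in> L_inf" using L_inf_factor that(1) by blast
    then show ?thesis using Suc.hyps(1)[OF card _ that(2)] Suc.prems(1,3) card by simp
  qed simp
  have "length u1 < 2 ^ k" using part[of "[]" u1] Suc.prems(2,4) x12 by (auto simp: u)
  moreover have "length u2 < 2 ^ k"
    using part[of "concat (map \<phi> u1) @ \<phi> x" u2 "[]"] Suc.prems(2,4) x12 by (auto simp: u)
  ultimately show ?case using Suc.hyps(2)[symmetric] by (simp add: u)
qed

section \<open>Minimality of the Zimin words\<close>

lemma satisfies_of_mem_variety_of:
  "A \<in> variety_of S \<Longrightarrow> algebra S \<Longrightarrow> satisfies S e \<Longrightarrow> satisfies A e"
  using mem_variety_of_iff by blast

lemma F_inf_in_variety_imp_minimal:
  assumes S: "ai_semiring S" and F: "F_inf \<in> variety_of S" and m: "m \<ge> 1"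
  shows "minimal_for (zimin m) S"
proof -
  have "u = zimin m" if u: "u \<noteq> []"
    and su: "satisfies S (Add (word_term u) (word_term (zimin m)), word_term (zimin m))" for u
  proof -
    \<comment> \<open>Every variable but \<open>0\<close> stands for its own letter. As
      \<open>0\<close> is not a letter of the infinite word, it is sent to a letter that
      \<open>zimin m\<close> lacks, so that an occurrence of \<open>0\<close> in \<open>u\<close>
      would show in the image.\<close>
    define \<psi> :: "nat \<Rightarrow> nat list" where "\<psi> x = (if x = 0 then [Suc m] else [x])" for x
    have z: "zimin m \<noteq> []" "0 \<notin> set (zimin m)" using m by (auto simp: set_zimin Suc_le_eq gr0_conv_Suc)
    have id: "concat (map \<psi> v) = v" if "0 \<notin> set v" for v
      using that by (induction v) (auto simp: \<psi>_def)
    have "algebra S" using S by (simp add: ai_semiring_def)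
    then have "satisfies F_inf (Add (word_term u) (word_term (zimin m)), word_term (zimin m))"
      using satisfies_of_mem_variety_of[OF F _ su] by blast
    then have "concat (map \<psi> u) = zimin m"
      by (rule satisfies_F_inf_substitution[OF satisfies_sym])
        (use m z u id zimin_in_L_inf singleton_in_L_inf in \<open>auto simp: words_word_term \<psi>_def\<close>)
    moreover from this have "0 \<notin> set u"
    proof -
      have "Suc m \<in> set (concat (map \<psi> u))" if "0 \<in> set u"
        using that by (auto simp: \<psi>_def intro!: bexI[of _ 0])
      then show ?thesis using \<open>concat (map \<psi> u) = zimin m\<close> set_zimin[of m] by auto
    qed
    ultimately show ?thesis using id by simp
  qed
  then show ?thesis using m by (auto simp: minimal_for_def gr0_conv_Suc Suc_le_eq)
qed

section \<open>From minimality of the Zimin words to the identities of \<open>F_inf\<close>\<close>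

context
  fixes S :: "'a alg"
  assumes S: "ai_semiring S"
begin

lemma ai_semiring_algebra: "algebra S"
  using S by (simp add: ai_semiring_def)

lemma ai_semiring_closed:
  "x \<in> carrier S \<Longrightarrow> y \<in> carrier S \<Longrightarrow> add S x y \<in> carrier S"
  "x \<in> carrier S \<Longrightarrow> y \<in> carrier S \<Longrightarrow> mul S x y \<in> carrier S"
  using ai_semiring_algebra by (auto simp: algebra_def)

lemma ai_semiring_add:
  "x \<in> carrier S \<Longrightarrow> add S x x = x"
  "x \<in> carrier S \<Longrightarrow> y \<in> carrier S \<Longrightarrow> add S x y = add S y x"
  "x \<in> carrier S \<Longrightarrow> y \<in> carrier S \<Longrightarrow> z \<in> carrier S \<Longrightarrow> add S (add S x y) z = add S x (add S y z)"
  using S by (simp_all add: ai_semiring_def)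

lemma ai_semiring_mul:
  "x \<in> carrier S \<Longrightarrow> y \<in> carrier S \<Longrightarrow> z \<in> carrier S \<Longrightarrow> mul S (mul S x y) z = mul S x (mul S y z)"
  "x \<in> carrier S \<Longrightarrow> y \<in> carrier S \<Longrightarrow> z \<in> carrier S \<Longrightarrow> mul S x (add S y z) = add S (mul S x y) (mul S x z)"
  "x \<in> carrier S \<Longrightarrow> y \<in> carrier S \<Longrightarrow> z \<in> carrier S \<Longrightarrow> mul S (add S x y) z = add S (mul S x z) (mul S y z)"
  using S by (simp_all add: ai_semiring_def)

lemma eval_word_term_append:
  assumes "range g \<subseteq> carrier S" "u \<noteq> []" "v \<noteq> []"
  shows "eval S g (word_term (u @ v)) = mul S (eval S g (word_term u)) (eval S g (word_term v))"
  using assms(2,3)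
proof (induction u rule: word_term.induct)
  case (1 x)
  then show ?case by (cases v) auto
next
  case (2 x y u)
  have c: "eval S g t \<in> carrier S" for t
    using eval_closed[OF ai_semiring_algebra, of g] assms(1) by blast
  have "mul S (g x) (mul S (eval S g (word_term (y # u))) (eval S g (word_term v))) =
      mul S (mul S (g x) (eval S g (word_term (y # u)))) (eval S g (word_term v))"
    using c[of "Var x"] c by (simp add: ai_semiring_mul)
  then show ?case using 2 by simp
qed auto

text \<open>By cancellation the words of each factor of a product share an image, so the induction
  applies to both factors; in a sum, idempotence joins two equal values.\<close>

lemma eval_eq_common_word:
  assumes g: "range g \<subseteq> carrier S" and \<phi>: "\<And>x. \<phi> x \<noteq> []"
    and "\<And>u. u \<in> words t \<Longrightarrow> concat (map \<phi> u) = w"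
  shows "eval S (\<lambda>x. eval S g (word_term (\<phi> x))) t = eval S g (word_term w)"
  using assms(3)
proof (induction t arbitrary: w)
  case (Add s t)
  have "eval S g (word_term w) \<in> carrier S"
    using eval_closed[OF ai_semiring_algebra, of g] g by blast
  then show ?case using Add.IH[of w] Add.prems by (simp add: ai_semiring_add)
next
  case (Mul s t)
  let ?c = "\<lambda>u. concat (map \<phi> u)"
  obtain u0 v0 where u0: "u0 \<in> words s" and v0: "v0 \<in> words t"
    using words_nonempty by blast
  have B: "?c u @ ?c v = w" if "u \<in> words s" "v \<in> words t" for u v
    using Mul.prems[of "u @ v"] that by auto
  have "?c u = ?c u0" if "u \<in> words s" for u
    using B[OF that v0] B[OF u0 v0] by (metis append_same_eq)
  moreover have "?c v = ?c v0" if "v \<in> words t" for v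
    using B[OF u0 that] B[OF u0 v0] by (metis same_append_eq)
  moreover have "?c u0 \<noteq> []" "?c v0 \<noteq> []"
    using u0 v0 Nil_notin_words[of s] Nil_notin_words[of t] \<phi> by (auto simp: concat_map_eq_Nil_iff)
  ultimately show ?case
    using Mul.IH(1)[of "?c u0"] Mul.IH(2)[of "?c v0"] B[OF u0 v0]
      eval_word_term_append[OF g, of "?c u0" "?c v0"] by simp
qed auto

text \<open>In the order where \<open>x\<close> is below \<open>y\<close> iff
  \<open>x + y = y\<close>, a word is below every term that contains it, because addition and
  multiplication are monotone.\<close>

lemma word_le_eval:
  assumes h: "range h \<subseteq> carrier S" and "u \<in> words t"
  shows "add S (eval S h (word_term u)) (eval S h t) = eval S h t"
  using assms(2)
proof (induction t arbitrary: u)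
  case (Var x)
  moreover have "h x \<in> carrier S" using h by auto
  ultimately show ?case by (simp add: ai_semiring_add)
next
  case (Add s t)
  let ?u = "eval S h (word_term u)" and ?s = "eval S h s" and ?t = "eval S h t"
  have c: "?u \<in> carrier S" "?s \<in> carrier S" "?t \<in> carrier S"
    using eval_closed[OF ai_semiring_algebra, of h] h by blast+
  consider "add S ?u ?s = ?s" | "add S ?u ?t = ?t" using Add by auto
  then show ?case
  proof cases
    case 1
    then have "add S (add S ?u ?s) ?t = add S ?s ?t" by simp
    then show ?thesis using c by (simp add: ai_semiring_add(3))
  next
    case 2
    then have "add S (add S ?u ?t) ?s = add S ?t ?s" by simp
    then have "add S ?u (add S ?t ?s) = add S ?t ?s" using c by (simp add: ai_semiring_add(3))
    then show ?thesis using ai_semiring_add(2)[OF c(3,2)] by simp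
  qed
next
  case (Mul s t)
  then obtain u1 u2 where u: "u = u1 @ u2" "u1 \<in> words s" "u2 \<in> words t" by auto
  let ?u = "eval S h (word_term u1)" and ?v = "eval S h (word_term u2)"
    and ?s = "eval S h s" and ?t = "eval S h t"
  have c: "?u \<in> carrier S" "?v \<in> carrier S" "?s \<in> carrier S" "?t \<in> carrier S"
    using eval_closed[OF ai_semiring_algebra, of h] h by blast+
  have le: "add S ?u ?s = ?s" "add S ?v ?t = ?t" using Mul.IH u by auto
  have "u1 \<noteq> []" "u2 \<noteq> []" using u Nil_notin_words[of s] Nil_notin_words[of t] by auto
  then have e: "eval S h (word_term u) = mul S ?u ?v"
    using eval_word_term_append[OF h] u by simp
  have m: "mul S ?u ?v \<in> carrier S" "mul S ?u ?t \<in> carrier S" "mul S ?s ?t \<in> carrier S"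
    using c ai_semiring_closed(2) by blast+
  have 1: "add S (mul S ?u ?t) (mul S ?s ?t) = mul S ?s ?t"
    using ai_semiring_mul(3)[OF c(1,3,4)] unfolding le(1) by (rule sym)
  have 2: "add S (mul S ?u ?v) (mul S ?u ?t) = mul S ?u ?t"
    using ai_semiring_mul(2)[OF c(1,2,4)] unfolding le(2) by (rule sym)
  have "add S (mul S ?u ?v) (mul S ?s ?t) = mul S ?s ?t"
    using ai_semiring_add(3)[OF m] unfolding 1 2 by (rule sym)
  then show ?case using e by simp
qed

text \<open>Under the assignment induced by \<open>\<phi>\<close>, \<open>s\<close> has the value of
  \<open>w\<close>; hence so has \<open>t\<close>, and the image of \<open>v\<close> lies below
  \<open>w\<close>. Multiplying by the context \<open>p\<close>, \<open>q\<close> of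
  \<open>w\<close> in a Zimin word gives an identity to which minimality applies; then
  \<open>p\<close> and \<open>q\<close> are cancelled.\<close>

lemma minimal_imp_substitution:
  assumes min: "\<And>m. m \<ge> 1 \<Longrightarrow> minimal_for (zimin m) S" and st: "satisfies S (s, t)"
    and \<phi>: "\<And>x. \<phi> x \<noteq> []" and w: "w \<in> L_inf"
    and u: "\<And>u. u \<in> words s \<Longrightarrow> concat (map \<phi> u) = w" and v: "v \<in> words t"
  shows "concat (map \<phi> v) = w"
proof -
  obtain m p q where z: "zimin m = p @ w @ q" by (rule L_inf_sublist_zimin[OF w])
  have wne: "w \<noteq> []" using w L_inf_nonempty by auto
  let ?wv = "concat (map \<phi> v)"
  have vne: "?wv \<noteq> []" using v Nil_notin_words[of t] \<phi> by (auto simp: concat_map_eq_Nil_iff)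
  have "add S (eval S g (word_term (p @ ?wv @ q))) (eval S g (word_term (zimin m))) =
      eval S g (word_term (zimin m))" if g: "range g \<subseteq> carrier S" for g
  proof -
    let ?e = "\<lambda>w. eval S g (word_term w)"
    have c: "?e w \<in> carrier S" for w
      using eval_closed[OF ai_semiring_algebra, of g] g by blast
    let ?h = "\<lambda>x. ?e (\<phi> x)"
    have h: "range ?h \<subseteq> carrier S" using c by auto
    have "?e w = eval S ?h s" using eval_eq_common_word[where \<phi> = \<phi>, OF g \<phi> u] by simp
    also have "\<dots> = eval S ?h t" using st h by (simp add: satisfies_def)
    finally have "add S (eval S ?h (word_term v)) (?e w) = ?e w"
      using word_le_eval[OF h v] by simp
    moreover have "eval S ?h (word_term v) = ?e ?wv"
    proof (rule eval_eq_common_word[where \<phi> = \<phi>, OF g \<phi>])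
      have "v \<noteq> []" using v Nil_notin_words by blast
      then show "concat (map \<phi> u) = ?wv" if "u \<in> words (word_term v)" for u
        using that words_word_term by fastforce
    qed
    ultimately have 1: "add S (?e ?wv) (?e w) = ?e w" by simp
    \<comment> \<open>\<open>p\<close> and \<open>q\<close> may be empty, where
      \<open>word_term\<close> has no defining equation, so they are multiplied on only in the other
      case.\<close>
    have 2: "add S (?e (p @ ?wv)) (?e (p @ w)) = ?e (p @ w)"
    proof (cases "p = []")
      case False
      then show ?thesis using 1 wne vne c ai_semiring_mul(2)[of "?e p" "?e ?wv" "?e w"]
        by (simp add: eval_word_term_append[OF g])
    qed (use 1 in simp)
    show ?thesis
    proof (cases "q = []")
      case False
      have "?e (p @ ?wv @ q) = mul S (?e (p @ ?wv)) (?e q)" "?e (p @ w @ q) = mul S (?e (p @ w)) (?e q)"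
        using False wne vne eval_word_term_append[OF g, of "p @ ?wv" q]
          eval_word_term_append[OF g, of "p @ w" q] by simp_all
      then show ?thesis using 2 c ai_semiring_mul(3)[of "?e (p @ ?wv)" "?e (p @ w)" "?e q"]
        by (simp add: z)
    qed (use 2 z in simp)
  qed
  then have "satisfies S (Add (word_term (p @ ?wv @ q)) (word_term (zimin m)), word_term (zimin m))"
    by (simp add: satisfies_def)
  moreover have "m \<ge> 1" using z wne by (cases m) auto
  ultimately have "p @ ?wv @ q = zimin m" using min vne by (simp add: minimal_for_def)
  then show ?thesis using z by simp
qed

lemma minimal_imp_F_inf_in_variety:
  assumes min: "\<And>m. m \<ge> 1 \<Longrightarrow> minimal_for (zimin m) S"
  shows "F_inf \<in> variety_of S"
proof -
  have "satisfies F_inf e" if "satisfies S e" for e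
  proof -
    obtain s0 t0 where e: "e = (s0, t0)" by (cases e)
    have "satisfies (flat L_inf) (s0, t0)"
    proof (rule satisfies_flatI)
      fix h w s t
      assume h: "range h \<subseteq> carrier (flat L_inf)" and st: "{s, t} = {s0, t0}"
        and s: "eval (flat L_inf) h s = Some w"
      note h = h[folded F_inf_def]
      have S_st: "satisfies S (s, t)"
        using that st satisfies_sym by (auto simp: e doubleton_eq_iff)
      note s = s[folded F_inf_def, unfolded eval_F_inf_eq_Some_iff[OF h]]
      \<comment> \<open>\<open>M\<close> is a letter outside \<open>w\<close>. Variables with value
        zero are sent to it, so that an image equal to \<open>w\<close> shows that no such variable
        occurs.\<close>
      define M where "M = Suc (Max (insert 0 (set w)))"
      have M: "M \<notin> set w" unfolding M_def
        by (metis List.finite_set Max_ge Suc_n_not_le_n finite_insert insertCI)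
      define \<phi> where "\<phi> x = (case h x of None \<Rightarrow> [M] | Some y \<Rightarrow> y)" for x
      have \<phi>: "\<phi> x \<noteq> []" for x
      proof -
        have "h x \<in> carrier F_inf" using h by auto
        then show ?thesis
          using L_inf_nonempty by (auto simp: \<phi>_def F_inf_def flat_def split: option.splits)
      qed
      have the: "concat (map (the \<circ> h) u) = concat (map \<phi> u)" if "\<forall>x\<in>set u. h x \<noteq> None" for u
        using that by (induction u) (auto simp: \<phi>_def)
      have *: "concat (map \<phi> v) = w" if "v \<in> words t" for v
        by (rule minimal_imp_substitution[OF min S_st \<phi> _ _ that]) (use s the in auto)
      have "\<forall>x\<in>set v. h x \<noteq> None" if "v \<in> words t" for v
      proof (intro ballI notI)
        fix x assume "x \<in> set v" "h x = None"
        then have "M \<in> set (concat (map \<phi> v))" by (auto simp: \<phi>_def intro!: bexI[of _ x])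
        then show False using * that M by simp
      qed
      then have "eval F_inf h t = Some w"
        unfolding eval_F_inf_eq_Some_iff[OF h] using s the * by metis
      then show "eval (flat L_inf) h t = Some w" by (simp add: F_inf_def)
    qed (use L_inf_factor L_inf_nonempty in blast)+
    then show ?thesis by (simp add: e F_inf_def)
  qed
  then show ?thesis
    unfolding mem_variety_of_iff[OF ai_semiring_algebra] using algebra_F_inf by blast
qed

end

section \<open>Local finiteness\<close>

lemma eval_F_inf_long_word:
  assumes "range h \<subseteq> carrier F_inf" "u \<in> words t" "finite Y" "set u \<subseteq> Y" "2 ^ card Y \<le> length u"
  shows "eval F_inf h t = None"
proof (rule ccontr)
  assume "eval F_inf h t \<noteq> None"
  then obtain w where "eval F_inf h t = Some w" by blast
  note w = this[unfolded eval_F_inf_eq_Some_iff[OF assms(1)]]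
  have hx: "h x \<in> carrier F_inf" for x using assms(1) by auto
  define \<phi> where "\<phi> x = (if x \<in> set u then the (h x) else [1])" for x
  have "the (h x) \<noteq> []" if "x \<in> set u" for x
  proof -
    have "h x \<noteq> None" using w assms(2) that by blast
    then show ?thesis using hx[of x] L_inf_nonempty by (auto simp: F_inf_def flat_def)
  qed
  moreover have "concat (map \<phi> u) = concat (map (the \<circ> h) u)"
    by (rule arg_cong[where f = concat]) (simp add: \<phi>_def)
  ultimately have "length u < 2 ^ card Y"
    by (intro L_inf_image_length[OF assms(3,4), of \<phi>]) (use w assms(2) in \<open>auto simp: \<phi>_def\<close>)
  then show False using assms(5) by simp
qed

text \<open>In \<open>k\<close> variables, a term with a word of length at least
  \<open>2 ^ k\<close> is zero in \<open>F_inf\<close>, and any other is determined by its words, a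
  subset of a finite set. So \<open>k\<close> generators yield only finitely many values.\<close>

lemma locally_finite_variety_of_F_inf: "locally_finite (variety_of F_inf)"
  unfolding locally_finite_def
proof (intro ballI impI)
  fix A :: "'a alg" assume A: "A \<in> variety_of F_inf" and "finitely_generated A"
  then obtain X where X: "finite X" "X \<subseteq> carrier A" "generated A X = carrier A"
    by (auto simp: finitely_generated_def)
  have alg: "algebra A" using A by (simp add: mem_variety_of_iff[OF algebra_F_inf])
  obtain a where a: "a \<in> carrier A" using alg by (auto simp: algebra_def)
  obtain h0 :: "nat \<Rightarrow> 'a" and k where h0: "X = h0 ` {i. i < k}"
    using finite_imp_nat_seg_image_inj_on[OF X(1)] by blast
  define h where "h i = (if i < k then h0 i else a)" for i
  have h: "h i \<in> carrier A" for i using a X(2) h0 by (auto simp: h_def)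
  \<comment> \<open>The empty set is the code of zero. No clash arises because
    \<open>words t\<close> is never empty.\<close>
  define nf :: "nat trm \<Rightarrow> nat list set" where
    "nf t = (if \<exists>u\<in>words t. 2 ^ k \<le> length u then {} else words t)" for t
  define T where "T = {t :: nat trm. set_trm t \<subseteq> {..<k}}"
  have "eval A h s = eval A h t" if "s \<in> T" "t \<in> T" "nf s = nf t" for s t
  proof -
    have "eval F_inf g s = eval F_inf g t" if g: "range g \<subseteq> carrier F_inf" for g
    proof (cases "nf s = {}")
      case True
      have "eval F_inf g r = None" if "nf r = {}" "r \<in> T" for r
      proof -
        have "\<exists>u\<in>words r. 2 ^ k \<le> length u"
          using that(1) words_nonempty[of r] by (auto simp: nf_def split: if_splits)
        then obtain u where u: "u \<in> words r" "2 ^ k \<le> length u" by blast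
        have "set u \<subseteq> {..<k}" using set_words[OF u(1)] that by (auto simp: T_def)
        then show ?thesis using eval_F_inf_long_word[OF g u(1), of "{..<k}"] u(2) by simp
      qed
      then show ?thesis using True \<open>s \<in> T\<close> \<open>t \<in> T\<close> \<open>nf s = nf t\<close> by simp
    next
      case False
      then have "words s = words t" using \<open>nf s = nf t\<close> by (auto simp: nf_def split: if_splits)
      then have iff: "eval F_inf g s = Some w \<longleftrightarrow> eval F_inf g t = Some w" for w
        unfolding eval_F_inf_eq_Some_iff[OF g] by simp
      show ?thesis
        using iff[of "the (eval F_inf g s)"] iff[of "the (eval F_inf g t)"]
        by (cases "eval F_inf g s"; cases "eval F_inf g t") simp_all
    qed
    then have "satisfies F_inf (s, t)" by (simp add: satisfies_def)
    then have "satisfies A (s, t)" using A algebra_F_inf satisfies_of_mem_variety_of by blast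
    then show ?thesis using h by (simp add: satisfies_def image_subset_iff)
  qed
  moreover have "finite (nf ` T)"
  proof -
    have "nf t \<subseteq> {u. set u \<subseteq> {..<k} \<and> length u \<le> 2 ^ k}" if "t \<in> T" for t
    proof
      fix u assume "u \<in> nf t"
      then have "u \<in> words t" "length u < 2 ^ k"
        unfolding nf_def by (auto simp: not_le split: if_splits)
      then show "u \<in> {u. set u \<subseteq> {..<k} \<and> length u \<le> 2 ^ k}"
        using set_words[of u t] that by (auto simp: T_def)
    qed
    then have "nf ` T \<subseteq> Pow {u. set u \<subseteq> {..<k} \<and> length u \<le> 2 ^ k}" by blast
    then show ?thesis by (rule finite_subset) (simp add: finite_lists_length_le)
  qed
  ultimately have "finite (eval A h ` T)"
  proof -
    assume *: "\<And>s t. s \<in> T \<Longrightarrow> t \<in> T \<Longrightarrow> nf s = nf t \<Longrightarrow> eval A h s = eval A h t" "finite (nf ` T)"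
    have "eval A h t = eval A h (inv_into T nf (nf t))" if "t \<in> T" for t
      using *(1)[OF that, of "inv_into T nf (nf t)"] that
      by (simp add: inv_into_into f_inv_into_f)
    then have "eval A h ` T \<subseteq> (\<lambda>n. eval A h (inv_into T nf n)) ` nf ` T"
      unfolding image_image by (intro image_subsetI) (rule image_eqI)
    then show ?thesis using *(2) finite_subset by blast
  qed
  moreover have "carrier A \<subseteq> eval A h ` T"
  proof -
    have "subuniverse A (eval A h ` T)"
      unfolding subuniverse_def
    proof (intro conjI ballI)
      show "eval A h ` T \<subseteq> carrier A" using eval_closed[of A h] alg h by auto
      fix x y assume "x \<in> eval A h ` T" "y \<in> eval A h ` T"
      then obtain s t where st: "s \<in> T" "t \<in> T" "x = eval A h s" "y = eval A h t" by blast
      have "Add s t \<in> T" "Mul s t \<in> T" using st by (auto simp: T_def)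
      then show "add A x y \<in> eval A h ` T" "mul A x y \<in> eval A h ` T"
        using st imageI[of "Add s t" T "eval A h"] imageI[of "Mul s t" T "eval A h"] by simp_all
    qed
    moreover have "X \<subseteq> eval A h ` T"
    proof
      fix x assume "x \<in> X"
      then obtain i where "i < k" "x = h0 i" using h0 by auto
      then have "Var i \<in> T" "x = eval A h (Var i)" by (simp_all add: T_def h_def)
      then show "x \<in> eval A h ` T" by blast
    qed
    ultimately show ?thesis using X(3) unfolding generated_def by blast
  qed
  ultimately show "finite (carrier A)" by (rule rev_finite_subset)
qed

text \<open>All squares are zero in \<open>F_inf\<close>, since \<open>[i, i]\<close> has length
  \<open>2 ^ 1\<close>. In the Brandt semiring \<open>B1\<close> and \<open>Bc\<close> have the
  different squares \<open>B1\<close> and \<open>B0\<close>.\<close>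

lemma brandt_not_in_variety_of_F_inf: "brandt_semiring \<notin> variety_of F_inf"
proof
  assume B: "brandt_semiring \<in> variety_of F_inf"
  have "eval F_inf h (Mul (Var i) (Var i)) = None" if "range h \<subseteq> carrier F_inf" for h and i :: nat
    by (rule eval_F_inf_long_word[OF that, of "[i, i]" _ "{i}"]) auto
  then have "satisfies F_inf (Mul (Var 0) (Var 0), Mul (Var 1) (Var 1))"
    by (simp only: satisfies_def fst_conv snd_conv) simp
  then have "satisfies brandt_semiring (Mul (Var 0) (Var 0), Mul (Var 1) (Var 1))"
    by (rule satisfies_of_mem_variety_of[OF B algebra_F_inf])
  then show False
    by (auto simp: satisfies_def brandt_semiring_def dest!: spec[of _ "\<lambda>i::nat. if i = 0 then B1 else Bc"])
qed

section \<open>Isomorphic copies\<close>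

text \<open>Flat semirings have their own element types, while a variety collects algebras over one
  universe type; an injection moves an algebra into that universe.\<close>

definition copy_alg :: "('a \<Rightarrow> 'b) \<Rightarrow> 'a alg \<Rightarrow> 'b alg" where
  "copy_alg f A = \<lparr>
     carrier = f ` carrier A,
     add = (\<lambda>x y. f (add A (inv f x) (inv f y))),
     mul = (\<lambda>x y. f (mul A (inv f x) (inv f y)))\<rparr>"

lemma copy_alg_simps:
  assumes "inj f"
  shows "carrier (copy_alg f A) = f ` carrier A"
    "add (copy_alg f A) (f x) (f y) = f (add A x y)"
    "mul (copy_alg f A) (f x) (f y) = f (mul A x y)"
  using assms by (simp_all add: copy_alg_def)

lemma eval_copy_alg:
  assumes "inj f"
  shows "eval (copy_alg f A) (f \<circ> h) t = f (eval A h t)"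
  by (induction t) (simp_all add: copy_alg_simps[OF assms])

lemma satisfies_copy_alg:
  assumes f: "inj f"
  shows "satisfies (copy_alg f A) e \<longleftrightarrow> satisfies A e"
proof
  assume c: "satisfies (copy_alg f A) e"
  show "satisfies A e"
    unfolding satisfies_def
  proof (intro allI impI)
    fix h :: "nat \<Rightarrow> _" assume "range h \<subseteq> carrier A"
    then have "range (f \<circ> h) \<subseteq> carrier (copy_alg f A)" by (auto simp: copy_alg_simps[OF f])
    then have "f (eval A h (fst e)) = f (eval A h (snd e))"
      using c unfolding satisfies_def eval_copy_alg[OF f, symmetric] by blast
    then show "eval A h (fst e) = eval A h (snd e)" using f by (simp add: inj_eq)
  qed
next
  assume A: "satisfies A e"
  show "satisfies (copy_alg f A) e"
    unfolding satisfies_def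
  proof (intro allI impI)
    fix k :: "nat \<Rightarrow> _" assume k: "range k \<subseteq> carrier (copy_alg f A)"
    have "inv f (k x) \<in> carrier A" "f (inv f (k x)) = k x" for x
    proof -
      have "k x \<in> f ` carrier A" using k by (auto simp: copy_alg_simps[OF f])
      then obtain a where "a \<in> carrier A" "k x = f a" by blast
      then show "inv f (k x) \<in> carrier A" "f (inv f (k x)) = k x" using f by simp_all
    qed
    then have "range (inv f \<circ> k) \<subseteq> carrier A" "f \<circ> (inv f \<circ> k) = k" by auto
    then show "eval (copy_alg f A) k (fst e) = eval (copy_alg f A) k (snd e)"
      using A eval_copy_alg[OF f, of A "inv f \<circ> k"] by (simp add: satisfies_def)
  qed
qed

lemma algebra_copy_alg: "inj f \<Longrightarrow> algebra A \<Longrightarrow> algebra (copy_alg f A)"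
  by (auto simp: algebra_def copy_alg_simps)

lemma finitely_generated_copy_alg:
  assumes f: "inj f" and alg: "algebra A" and A: "finitely_generated A"
  shows "finitely_generated (copy_alg f A)"
proof -
  obtain X where X: "finite X" "X \<subseteq> carrier A" "generated A X = carrier A"
    using A by (auto simp: finitely_generated_def)
  have "carrier (copy_alg f A) \<subseteq> B" if B: "subuniverse (copy_alg f A) B" "f ` X \<subseteq> B" for B
  proof -
    have "subuniverse A (f -` B \<inter> carrier A)"
      unfolding subuniverse_def
    proof (intro conjI ballI)
      fix x y assume xy: "x \<in> f -` B \<inter> carrier A" "y \<in> f -` B \<inter> carrier A"
      then have "add (copy_alg f A) (f x) (f y) \<in> B" "mul (copy_alg f A) (f x) (f y) \<in> B"
        using B(1) by (auto simp: subuniverse_def)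
      moreover from this have "f (add A x y) \<in> f ` carrier A" "f (mul A x y) \<in> f ` carrier A"
        using B(1) by (auto simp: subuniverse_def copy_alg_simps[OF f])
      ultimately show "add A x y \<in> f -` B \<inter> carrier A" "mul A x y \<in> f -` B \<inter> carrier A"
        using f by (auto simp: copy_alg_simps[OF f] inj_image_mem_iff)
    qed blast
    moreover have "X \<subseteq> f -` B \<inter> carrier A" using B(2) X(2) by blast
    ultimately have "generated A X \<subseteq> f -` B \<inter> carrier A" unfolding generated_def by blast
    then show ?thesis using X(3) by (auto simp: copy_alg_simps[OF f])
  qed
  moreover have "subuniverse (copy_alg f A) (carrier (copy_alg f A))"
    using algebra_copy_alg[OF f alg] by (auto simp: subuniverse_def algebra_def)
  moreover have fX: "f ` X \<subseteq> carrier (copy_alg f A)"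
    using X(2) by (auto simp: copy_alg_simps[OF f])
  ultimately have "generated (copy_alg f A) (f ` X) = carrier (copy_alg f A)"
    unfolding generated_def by blast
  then show ?thesis
    unfolding finitely_generated_def using X(1) fX by blast
qed

section \<open>Self-similarity of the infinite Zimin word\<close>

lemma zimin_inf_eq_nth:
  assumes "n < 2 ^ m - 1"
  shows "zimin_inf n = zimin m ! n"
proof -
  have n: "n < length (zimin m)" using assms by (simp add: length_zimin)
  then have "map zimin_inf [0..<length (zimin m)] ! n = zimin_inf n" by simp
  then show ?thesis unfolding zimin_prefix by simp
qed

lemma zimin_inf_pow: "zimin_inf (2 ^ m - 1) = Suc m"
proof -
  have "zimin_inf (2 ^ m - 1) = zimin (Suc m) ! (2 ^ m - 1)"
  proof (rule zimin_inf_eq_nth)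
    have "(0 :: nat) < 2 ^ m" by simp
    then show "2 ^ m - 1 < (2 ^ Suc m - 1 :: nat)" unfolding power_Suc by linarith
  qed
  also have "\<dots> = Suc m" using length_zimin[of m] by (simp add: nth_append)
  finally show ?thesis .
qed

lemma zimin_inf_pow_add:
  assumes "n < 2 ^ m - 1"
  shows "zimin_inf (2 ^ m + n) = zimin_inf n"
proof -
  have "zimin_inf (2 ^ m + n) = zimin (Suc m) ! (2 ^ m + n)"
    by (rule zimin_inf_eq_nth) (use assms in simp)
  also have *: "2 ^ m + n = length (zimin m) + Suc n"
    by (simp add: length_zimin)
  also have "zimin (Suc m) ! (length (zimin m) + Suc n) = zimin m ! n"
    by (simp add: nth_append)
  finally have "zimin_inf (2 ^ m + n) = zimin m ! n" unfolding * .
  then show ?thesis using zimin_inf_eq_nth[OF assms] by simp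
qed

text \<open>This is the ruler sequence: the letter \<open>1\<close> alternates with the letters of
  the word itself raised by one. The induction removes a power of two from \<open>n\<close>, passing
  from the second copy of a Zimin word to the first.\<close>

lemma zimin_inf_double: "zimin_inf (2 * n) = 1" "zimin_inf (Suc (2 * n)) = Suc (zimin_inf n)"
proof (induction n rule: less_induct)
  case (less n)
  have pow: "\<exists>m. 2 ^ m \<le> k \<and> k < 2 ^ Suc m" if "0 < k" for k :: nat
    using ex_power_ivl1[of 2 k] that by (auto simp: Suc_le_eq)
  show "zimin_inf (2 * n) = 1"
  proof (cases "n = 0")
    case True
    then show ?thesis using zimin_inf_pow[of 0] by simp
  next
    case False
    obtain m where m: "2 ^ m \<le> n" "n < 2 ^ Suc m" using pow[of n] False by auto
    define k where "k = n - 2 ^ m"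
    have k: "n = 2 ^ m + k" using m by (simp add: k_def)
    have "k < n" using m False unfolding k by simp
    have "2 * k < 2 ^ Suc m - 1" using m(2) unfolding k by simp
    then have "zimin_inf (2 ^ Suc m + 2 * k) = zimin_inf (2 * k)" by (rule zimin_inf_pow_add)
    then show ?thesis using less[OF \<open>k < n\<close>] by (simp add: k algebra_simps)
  qed
  obtain m where m: "2 ^ m \<le> Suc n" "Suc n < 2 ^ Suc m" using pow[of "Suc n"] by auto
  show "zimin_inf (Suc (2 * n)) = Suc (zimin_inf n)"
  proof (cases "Suc n = 2 ^ m")
    case True
    have "n = 2 ^ m - 1" "Suc (2 * n) = 2 ^ Suc m - 1" using True by auto
    then show ?thesis using zimin_inf_pow[of m] zimin_inf_pow[of "Suc m"] by metis
  next
    case False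
    define k where "k = n - 2 ^ m"
    have k: "n = 2 ^ m + k" using m False by (simp add: k_def)
    have "k < n" using one_le_power[of "2 :: nat" m] unfolding k by linarith
    have "k < 2 ^ m - 1" "Suc (2 * k) < 2 ^ Suc m - 1" using m(2) unfolding k by auto
    then have "zimin_inf (2 ^ m + k) = zimin_inf k"
      "zimin_inf (2 ^ Suc m + Suc (2 * k)) = zimin_inf (Suc (2 * k))"
      using zimin_inf_pow_add by blast+
    then show ?thesis using less[OF \<open>k < n\<close>] by (simp add: k algebra_simps)
  qed
qed

text \<open>Iterating the doubling \<open>K\<close> times cuts the word into blocks of length
  \<open>2 ^ K\<close>: a copy of \<open>zimin K\<close> followed by one letter above
  \<open>K\<close>, and these letters spell the same word raised by \<open>K\<close>.\<close>

lemma zimin_inf_block: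
  shows "k < 2 ^ K - 1 \<Longrightarrow> zimin_inf (2 ^ K * m + k) = zimin_inf k"
    and "zimin_inf (2 ^ K * m + (2 ^ K - 1)) = zimin_inf m + K"
proof (induction K arbitrary: k m)
  case (Suc K)
  {
    case 1
    show ?case
    proof (cases "even k")
      case True
      then obtain j where j: "k = 2 * j" by blast
      have "2 ^ Suc K * m + k = 2 * (2 ^ K * m + j)" by (simp add: j algebra_simps)
      then show ?thesis by (simp only: j zimin_inf_double)
    next
      case False
      then obtain j where j: "k = Suc (2 * j)" using oddE by fastforce
      have "2 ^ Suc K * m + k = Suc (2 * (2 ^ K * m + j))" by (simp add: j algebra_simps)
      moreover have "j < 2 ^ K - 1" using 1 by (simp add: j)
      ultimately show ?thesis using Suc.IH(1)[of j m] by (simp only: j zimin_inf_double)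
    qed
  next
    case (2 m)
    have "2 ^ Suc K * m = 2 * (2 ^ K * m)" by simp
    moreover have "2 ^ Suc K - 1 = Suc (2 * (2 ^ K - 1) :: nat)"
      using one_le_power[of "2 :: nat" K] unfolding power_Suc by linarith
    ultimately have "2 ^ Suc K * m + (2 ^ Suc K - 1) = Suc (2 * (2 ^ K * m + (2 ^ K - 1)))"
      unfolding distrib_left by linarith
    then show ?case using Suc.IH(2) by (simp add: zimin_inf_double)
  }
qed simp_all

text \<open>
  A cut in the infinite word is encoded by a cut \<open>g\<close> in the word of the letters above \<open>K\<close>, followed
  by a cut in the gap \<open>zimin K\<close> between two such letters.  The cuts in the gap are placed only in
  front of the first occurrences of letters, so that the next letter reveals the cut.
\<close>

definition zimin_cut :: "nat \<Rightarrow> nat \<Rightarrow> nat \<Rightarrow> nat" where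
  "zimin_cut K g i = 2 ^ K * g + (2 ^ i - 1)"

lemma Suc_cut: "Suc (zimin_cut K g i) = 2 ^ K * g + 2 ^ i"
  unfolding zimin_cut_def using one_le_power[of "2 :: nat" i] by simp

lemma cut_less_mult:
  assumes "i < K"
  shows "zimin_cut K g i < 2 ^ K * Suc g"
proof -
  have "(2 ^ i :: nat) < 2 ^ K" using assms by simp
  then show ?thesis using Suc_cut[of K g i] unfolding mult_Suc_right by linarith
qed

text \<open>A cut with \<open>i < K\<close> stays inside block \<open>g\<close>, so cuts are ordered
  lexicographically, by block and then by gap index.\<close>

lemma cut_less:
  assumes "g < g'" "i < K"
  shows "zimin_cut K g i < zimin_cut K g' i'"
proof -
  have "zimin_cut K g i < 2 ^ K * Suc g" by (rule cut_less_mult[OF assms(2)])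
  also have "\<dots> \<le> 2 ^ K * g'" using assms(1) by (intro mult_le_mono) auto
  also have "\<dots> \<le> zimin_cut K g' i'" unfolding zimin_cut_def by (rule le_add1)
  finally show ?thesis .
qed

lemma cut_less_same: "i < i' \<Longrightarrow> zimin_cut K g i < zimin_cut K g i'"
proof -
  assume "i < i'"
  then have "(2 ^ i :: nat) < 2 ^ i'" by simp
  moreover have "(1 :: nat) \<le> 2 ^ i" by simp
  ultimately show ?thesis unfolding zimin_cut_def by linarith
qed

lemma cut_eq_iff:
  assumes "i < K" "i' < K"
  shows "zimin_cut K g i = zimin_cut K g' i' \<longleftrightarrow> g = g' \<and> i = i'"
  using assms cut_less[of g g' i K i'] cut_less[of g' g i' K i]
    cut_less_same[of i i' K g] cut_less_same[of i' i K g]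
  by (cases g g' rule: linorder_cases; cases i i' rule: linorder_cases) auto

text \<open>Gap index \<open>i\<close> marks the place before the first \<open>Suc i\<close> in
  \<open>zimin K\<close>.\<close>

lemma zimin_inf_zimin_cut: "i < K \<Longrightarrow> zimin_inf (zimin_cut K g i) = Suc i"
proof -
  assume i: "i < K"
  then have "(2 ^ i :: nat) < 2 ^ K" by simp
  moreover have "(1 :: nat) \<le> 2 ^ i" by simp
  ultimately have "(2 ^ i - 1 :: nat) < 2 ^ K - 1" by linarith
  then show ?thesis unfolding zimin_cut_def using zimin_inf_block(1) zimin_inf_pow by metis
qed

text \<open>The distance between two cuts depends only on their gap indices and on the number of
  blocks between them, so a piece can be moved to another block.\<close>

lemma cut_diff:
  assumes "g \<le> h" "zimin_cut K g i \<le> zimin_cut K h j"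
  shows "zimin_cut K g' i + (zimin_cut K h j - zimin_cut K g i) = zimin_cut K (g' + (h - g)) j"
proof -
  have "2 ^ K * h = 2 ^ K * g + 2 ^ K * (h - g)"
    using assms(1) by (simp flip: distrib_left)
  then show ?thesis
    using assms(2) Suc_cut[of K g i] Suc_cut[of K h j] Suc_cut[of K g' i] Suc_cut[of K "g' + (h - g)" j]
    unfolding distrib_left by linarith
qed

text \<open>Positions inside a copy of \<open>zimin K\<close> agree by themselves; the last position
  of a block carries a letter of the outer word, and there the agreement at \<open>g\<close> and
  \<open>g'\<close> is used.\<close>

lemma cut_agree:
  assumes "g \<le> h" "\<And>t. t < h - g \<Longrightarrow> zimin_inf (g + t) = zimin_inf (g' + t)"
    and j: "j < K" and t: "t < zimin_cut K h j - zimin_cut K g i"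
  shows "zimin_inf (zimin_cut K g i + t) = zimin_inf (zimin_cut K g' i + t)"
proof -
  define x where "x = 2 ^ i - 1 + t"
  define s r where "s = x div 2 ^ K" and "r = x mod 2 ^ K"
  have x: "x = 2 ^ K * s + r" by (simp add: s_def r_def)
  have e: "zimin_cut K g i + t = 2 ^ K * (g + s) + r" "zimin_cut K g' i + t = 2 ^ K * (g' + s) + r"
    using x unfolding zimin_cut_def x_def distrib_left by linarith+
  have r: "r < 2 ^ K" by (simp add: r_def)
  show ?thesis
  proof (cases "r < 2 ^ K - 1")
    case True
    then show ?thesis unfolding e by (simp add: zimin_inf_block)
  next
    case False
    then have r: "r = 2 ^ K - 1" using r by simp
    have "Suc (zimin_cut K g i + t) = 2 ^ K * Suc (g + s)" unfolding e r by simp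
    then have "2 ^ K * Suc (g + s) \<le> zimin_cut K h j" using t by simp
    also have "\<dots> < 2 ^ K * Suc h" by (rule cut_less_mult[OF j])
    finally have "g + s < h" by simp
    then have "zimin_inf (g + s) = zimin_inf (g' + s)" by (intro assms(2)) simp
    then show ?thesis unfolding e r zimin_inf_block(2) by simp
  qed
qed

lemma cut_agreeD:
  assumes "g \<le> h" "i < K"
    and "\<And>t. t < zimin_cut K h j - zimin_cut K g i \<Longrightarrow> zimin_inf (zimin_cut K g' i + t) = zimin_inf (zimin_cut K g i + t)"
    and s: "s < h - g"
  shows "zimin_inf (g' + s) = zimin_inf (g + s)"
proof -
  have i: "(2 ^ i :: nat) < 2 ^ K" "(1 :: nat) \<le> 2 ^ i" using assms(2) by simp_all
  \<comment> \<open>The distance from cut \<open>i\<close> of a block to the last position of the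
    block \<open>s\<close> blocks further on; it is the same for every starting block.\<close>
  define t :: nat where "t = 2 ^ K * s + 2 ^ K - 2 ^ i"
  have e: "zimin_cut K f i + t = 2 ^ K * (f + s) + (2 ^ K - 1)" for f
    using i unfolding zimin_cut_def t_def distrib_left by linarith
  have "Suc (zimin_cut K g i + t) = 2 ^ K * Suc (g + s)" unfolding e by simp
  then have "zimin_cut K g i + t < 2 ^ K * Suc (g + s)" by simp
  also have "\<dots> \<le> 2 ^ K * h" using s by (intro mult_le_mono) auto
  also have "\<dots> \<le> zimin_cut K h j" unfolding zimin_cut_def by (rule le_add1)
  finally have "t < zimin_cut K h j - zimin_cut K g i" by simp
  then have "zimin_inf (zimin_cut K g' i + t) = zimin_inf (zimin_cut K g i + t)" by (rule assms(3))
  then show ?thesis unfolding e zimin_inf_block by simp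
qed

section \<open>Reading a word as a sequence of labelled intervals\<close>

text \<open>
  \<open>track R f v S E\<close>: the intervals \<open>[f a, f b)\<close>, for \<open>(a, b)\<close> in \<open>v\<close>, can be laid end to end so as to
  cover \<open>[S, E)\<close>, each point lying on a point to which it is related by \<open>R\<close>.
\<close>

fun track :: "(nat \<Rightarrow> nat \<Rightarrow> bool) \<Rightarrow> (nat \<Rightarrow> nat) \<Rightarrow> (nat \<times> nat) list \<Rightarrow> nat \<Rightarrow> nat \<Rightarrow> bool" where
  "track R f [] S E \<longleftrightarrow> S = E"
| "track R f ((a, b) # v) S E \<longleftrightarrow>
     (\<forall>t<f b - f a. R (S + t) (f a + t)) \<and> track R f v (S + (f b - f a)) E"

text \<open>The gap indices \<open>\<iota>\<close> match at the junctions, the intervals that are empty under \<open>f\<close> being skipped.\<close>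

fun itrack :: "(nat \<Rightarrow> nat) \<Rightarrow> (nat \<Rightarrow> nat) \<Rightarrow> (nat \<times> nat) list \<Rightarrow> nat \<Rightarrow> nat \<Rightarrow> bool" where
  "itrack f \<iota> [] i j \<longleftrightarrow> i = j"
| "itrack f \<iota> ((a, b) # v) i j \<longleftrightarrow>
     (if f a < f b then i = \<iota> a \<and> itrack f \<iota> v (\<iota> b) j else itrack f \<iota> v i j)"

lemma track_comp: "track R (g \<circ> f) v S E \<longleftrightarrow> track R g (map (map_prod f f) v) S E"
  by (induction v arbitrary: S) auto

text \<open>The positions of the tiles do not depend on the relation, so the relations can be joined
  pointwise. \<open>0 < r\<close> supplies the equality of the endpoints for the empty list.\<close>

lemma track_all:
  assumes "\<And>k. k < (r :: nat) \<Longrightarrow> track (R k) f v S E" "0 < r"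
  shows "track (\<lambda>x y. \<forall>k<r. R k x y) f v S E"
  using assms(1)
proof (induction v arbitrary: S)
  case Nil
  then show ?case using assms(2) by auto
next
  case (Cons p v)
  then show ?case by (cases p) auto
qed

lemma track_mono:
  "track R f v S E \<Longrightarrow> (\<And>x y. R x y \<Longrightarrow> Q x y) \<Longrightarrow> track Q f v S E"
proof (induction v arbitrary: S)
  case (Cons p v)
  then show ?case by (cases p) auto
qed simp

text \<open>The passage between equations of words and tracks, one interval at a time. A first
  interval that overshoots \<open>E\<close> makes both sides false.\<close>

lemma track_word:
  assumes "\<And>a b. (a, b) \<in> set v \<Longrightarrow> f a \<le> f b" "S \<le> E"
  shows "concat (map (\<lambda>(a, b). map \<alpha> [f a..<f b]) v) = map \<alpha> [S..<E] \<longleftrightarrow>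
    track (\<lambda>x y. \<alpha> x = \<alpha> y) f v S E"
  using assms
proof (induction v arbitrary: S)
  case (Cons p v)
  obtain a b where p: "p = (a, b)" by (cases p)
  let ?l = "f b - f a" and ?c = "concat (map (\<lambda>(a, b). map \<alpha> [f a..<f b]) v)"
  have "f a \<le> f b" using Cons.prems p by auto
  show ?case
  proof (cases "S + ?l \<le> E")
    case True
    have "[S..<E] = [S..<S + ?l] @ [S + ?l..<E]"
      using upt_add_eq_append[of S "S + ?l" "E - (S + ?l)"] True by simp
    then have "concat (map (\<lambda>(a, b). map \<alpha> [f a..<f b]) (p # v)) = map \<alpha> [S..<E] \<longleftrightarrow>
        map \<alpha> [f a..<f b] @ ?c = map \<alpha> [S..<S + ?l] @ map \<alpha> [S + ?l..<E]"
      by (simp add: p)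
    also have "\<dots> \<longleftrightarrow> map \<alpha> [f a..<f b] = map \<alpha> [S..<S + ?l] \<and> ?c = map \<alpha> [S + ?l..<E]"
      by simp
    also have "map \<alpha> [f a..<f b] = map \<alpha> [S..<S + ?l] \<longleftrightarrow> (\<forall>t<?l. \<alpha> (S + t) = \<alpha> (f a + t))"
      by (auto simp: list_eq_iff_nth_eq)
    also have "?c = map \<alpha> [S + ?l..<E] \<longleftrightarrow> track (\<lambda>x y. \<alpha> x = \<alpha> y) f v (S + ?l) E"
      using Cons.IH[of "S + ?l"] Cons.prems True by auto
    finally show ?thesis by (simp add: p)
  next
    case False
    have le: "S \<le> E" if "track R f v S E" for R S
      using that
    proof (induction v arbitrary: S)
      case (Cons q v)
      then show ?case by (cases q) fastforce
    qed simp
    have "\<not> track (\<lambda>x y. \<alpha> x = \<alpha> y) f v (S + ?l) E" using le False by blast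
    moreover have "concat (map (\<lambda>(a, b). map \<alpha> [f a..<f b]) (p # v)) \<noteq> map \<alpha> [S..<E]"
    proof
      assume "concat (map (\<lambda>(a, b). map \<alpha> [f a..<f b]) (p # v)) = map \<alpha> [S..<E]"
      from arg_cong[OF this, of length] show False using False Cons.prems(2) by (simp add: p)
    qed
    ultimately show ?thesis by (simp add: p)
  qed
qed auto

text \<open>At a nonempty interval the first letter reveals the gap index, the letters above
  \<open>K\<close> give the track of the outer cuts, and the length leads to a cut with the gap
  index of \<open>b\<close>. An interval that is empty under \<open>f\<close> is empty under
  \<open>g\<close> too and changes nothing.\<close>

lemma track_cut:
  assumes f: "\<And>n. f n = zimin_cut K (g n) (\<iota> n)" and \<iota>: "\<And>n. n \<in> B \<Longrightarrow> \<iota> n < K"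
    and v: "\<And>a b. (a, b) \<in> set v \<Longrightarrow> a \<in> B \<and> b \<in> B \<and> g a \<le> g b \<and> f a \<le> f b"
    and e: "e \<in> B" and i: "i < K"
    and t: "track (\<lambda>x y. zimin_inf x = zimin_inf y) f v (zimin_cut K S i) (f e)"
  shows "track (\<lambda>x y. zimin_inf x = zimin_inf y) g v S (g e) \<and> itrack f \<iota> v i (\<iota> e)"
  using v i t
proof (induction v arbitrary: S i)
  case Nil
  then show ?case using \<iota>[OF e] by (simp add: f cut_eq_iff)
next
  case (Cons p v)
  obtain a b where p: "p = (a, b)" by (cases p)
  have ab: "a \<in> B" "b \<in> B" "g a \<le> g b" "f a \<le> f b" using Cons.prems(1) p by auto
  have tl: "track (\<lambda>x y. zimin_inf x = zimin_inf y) f v (zimin_cut K S i + (f b - f a)) (f e)"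
    and hd: "\<And>t. t < f b - f a \<Longrightarrow> zimin_inf (zimin_cut K S i + t) = zimin_inf (f a + t)"
    using Cons.prems(3) by (auto simp: p)
  have v: "\<And>a b. (a, b) \<in> set v \<Longrightarrow> a \<in> B \<and> b \<in> B \<and> g a \<le> g b \<and> f a \<le> f b"
    using Cons.prems(1) by auto
  show ?case
  proof (cases "f a < f b")
    case True
    have "Suc i = Suc (\<iota> a)"
      using hd[of 0] True zimin_inf_zimin_cut Cons.prems(2) \<iota>[OF ab(1)] by (simp add: f)
    then have i: "i = \<iota> a" by simp
    have "zimin_cut K S i + (f b - f a) = zimin_cut K (S + (g b - g a)) (\<iota> b)"
      using cut_diff[OF ab(3)] ab(4) by (simp add: f i)
    then have "track (\<lambda>x y. zimin_inf x = zimin_inf y) g v (S + (g b - g a)) (g e) \<and> itrack f \<iota> v (\<iota> b) (\<iota> e)"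
      using Cons.IH[OF v \<iota>[OF ab(2)]] tl by simp
    moreover have "zimin_inf (S + t) = zimin_inf (g a + t)" if "t < g b - g a" for t
      using cut_agreeD[OF ab(3) \<iota>[OF ab(1)] _ that, of "\<iota> b" S] hd by (simp add: f i)
    ultimately show ?thesis using True i by (simp add: p)
  next
    case False
    then have "f a = f b" using ab by simp
    then have "g a = g b" using cut_eq_iff \<iota> ab by (simp add: f)
    then show ?thesis using Cons.IH[OF v Cons.prems(2)] tl \<open>f a = f b\<close> by (simp add: p)
  qed
qed

section \<open>An infinite word over a finite alphabet\<close>

text \<open>
  The position \<open>n = r * q + k\<close> with \<open>k < r\<close> is in column \<open>k\<close> of block \<open>q\<close>.  The letter at \<open>n\<close> shows its column,
  and, depending on the parity of the column, one of the two components of the letter at \<open>q\<close>.  So two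
  adjacent letters of a block determine the letter at \<open>q\<close>, which in turn determines the whole block.
\<close>

function rval :: "nat \<Rightarrow> nat \<Rightarrow> nat" where
  "rval r n = (if even (n mod r) then (n div r) mod r else rval r (n div r))"
  by pat_completeness auto
termination
proof (relation "measure snd")
  fix r n :: nat
  assume odd: "odd (n mod r)"
  then have "n \<noteq> 0" "r \<noteq> 1" by (auto intro!: Nat.gr0I)
  then have "n div r < n" by (cases "r = 0") simp_all
  then show "((r, n div r), (r, n)) \<in> measure snd" by simp
qed simp

declare rval.simps [simp del]

definition rword :: "nat \<Rightarrow> nat \<Rightarrow> nat \<times> nat" where
  "rword r n = (n mod r, rval r n)"

lemma rval_less: "0 < r \<Longrightarrow> rval r n < r"
  by (induction r n rule: rval.induct) (subst rval.simps, auto)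

lemma rval_block:
  "k < r \<Longrightarrow> rval r (r * q + k) = (if even k then q mod r else rval r q)"
  by (subst rval.simps) simp

lemma rval_cong: "k < r \<Longrightarrow> rword r q = rword r q' \<Longrightarrow> rval r (r * q + k) = rval r (r * q' + k)"
  by (simp add: rval_block rword_def)

text \<open>One of the columns \<open>c\<close> and \<open>Suc c\<close> is even and shows
  \<open>q mod r\<close>, the other shows \<open>rval r q\<close>; these are the two components of
  the letter at \<open>q\<close>.\<close>

lemma rword_decode:
  assumes "Suc c < r" "rword r (r * q + c) = rword r (r * q' + c)"
    "rword r (r * q + Suc c) = rword r (r * q' + Suc c)"
  shows "rword r q = rword r q'"
proof -
  have "rval r (r * q + k) = rval r (r * q' + k)" if "k = c \<or> k = Suc c" for k
    using that assms by (auto simp: rword_def)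
  from this[of c] this[of "Suc c"] show ?thesis
    using assms(1) by (cases "even c") (simp_all add: rval_block rword_def del: mult_Suc_right add_Suc_right)
qed

text \<open>
  \<open>beta r k n\<close> is the number of positions in column \<open>k\<close> before \<open>n\<close>, and \<open>gap r k n\<close> is the number of
  positions between the last of these and \<open>n\<close>.
\<close>

definition beta :: "nat \<Rightarrow> nat \<Rightarrow> nat \<Rightarrow> nat" where
  "beta r k n = (n + (r - Suc k)) div r"

definition gap :: "nat \<Rightarrow> nat \<Rightarrow> nat \<Rightarrow> nat" where
  "gap r k n = (n + (r - Suc k)) mod r"

lemma less_beta_iff:
  assumes "k < r"
  shows "q < beta r k n \<longleftrightarrow> r * q + k < n"
proof -
  have "q < beta r k n \<longleftrightarrow> Suc q * r \<le> n + (r - Suc k)"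
    unfolding beta_def Suc_le_eq[symmetric] using assms by (subst less_eq_div_iff_mult_less_eq) auto
  then show ?thesis using assms by (auto simp: mult.commute)
qed

lemma beta_le_iff: "k < r \<Longrightarrow> beta r k n \<le> q \<longleftrightarrow> n \<le> r * q + k"
  using less_beta_iff[of k r q n] by auto

lemma beta_gap: "n + (r - Suc k) = r * beta r k n + gap r k n"
  by (simp add: beta_def gap_def)

lemma beta_shift: "0 < r \<Longrightarrow> beta r k (n + r * M) = beta r k n + M"
proof -
  assume "0 < r"
  then have "((n + (r - Suc k)) + M * r) div r = M + (n + (r - Suc k)) div r"
    by (intro div_mult_self1) simp
  moreover have "n + r * M + (r - Suc k) = (n + (r - Suc k)) + M * r" by simp
  ultimately show ?thesis unfolding beta_def by presburger
qed

lemma beta_mono: "n \<le> n' \<Longrightarrow> beta r k n \<le> beta r k n'"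
  by (simp add: beta_def div_le_mono)

lemma beta_antimono: "k \<le> c \<Longrightarrow> c < r \<Longrightarrow> beta r c n \<le> beta r k n"
  by (simp add: beta_def div_le_mono)

lemma beta_le_Suc:
  assumes "k < r" "c < r"
  shows "beta r c n \<le> Suc (beta r k n)"
proof -
  have "n \<le> r * beta r k n + k" using beta_le_iff[OF assms(1)] by blast
  then have "n \<le> r * Suc (beta r k n) + c" using assms(1) by simp
  then show ?thesis using beta_le_iff[OF assms(2)] by blast
qed

lemma beta_add: "0 < r \<Longrightarrow> beta r k (n + l) = beta r k n + (gap r k n + l) div r"
proof -
  assume "0 < r"
  have e: "n + l + (r - Suc k) = r * beta r k n + (gap r k n + l)" using beta_gap[of n r k] by simp
  show ?thesis using \<open>0 < r\<close> unfolding beta_def[of r k "n + l"] e by simp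
qed

lemma gap_cong: "n mod r = n' mod r \<Longrightarrow> gap r k n = gap r k n'"
  unfolding gap_def by (metis mod_add_cong)

lemma gap_eq_imp:
  assumes "gap r k n = gap r k n'"
  shows "n mod r = n' mod r"
proof -
  have *: "n mod r = n' mod r" if "n \<le> n'" "gap r k n = gap r k n'" for n n'
  proof -
    have "r dvd (n' + (r - Suc k)) - (n + (r - Suc k))"
      using that unfolding gap_def by (subst mod_eq_dvd_iff_nat[symmetric]) auto
    then show ?thesis using that(1) by (simp add: mod_eq_dvd_iff_nat[of n n' r, symmetric] eq_commute)
  qed
  show ?thesis using *[of n n'] *[of n' n] assms by (metis nat_le_linear)
qed

text \<open>Gap zero means that the cut \<open>n\<close> runs between the columns \<open>c\<close>
  and \<open>Suc c\<close>, that is, separates the pair to which blocks will be contracted.\<close>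

lemma gap_eq_0_iff: "Suc c < r \<Longrightarrow> gap r c n = 0 \<longleftrightarrow> n mod r = Suc c"
proof -
  assume c: "Suc c < r"
  have "gap r c (Suc c) = 0" using c by (simp add: gap_def)
  then show ?thesis using gap_cong[of n r "Suc c" c] gap_eq_imp[of r c n "Suc c"] c by auto
qed

section \<open>Comparison of two factors in a single column\<close>

lemma mod_eq_cases:
  fixes a b r :: nat
  assumes "a mod r = b mod r"
  obtains M where "b = a + r * M" | M where "a = b + r * M"
proof (cases "a \<le> b")
  case True
  then have "r dvd b - a" using assms by (metis mod_eq_dvd_iff_nat)
  then show thesis using that(1) True by (metis dvdE le_add_diff_inverse)
next
  case False
  then have "r dvd a - b" using assms by (metis mod_eq_dvd_iff_nat nat_le_linear)
  then show thesis using that(2) False by (metis dvdE le_add_diff_inverse nat_le_linear)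
qed

text \<open>\<open>F\<close> is a function of the block number: with \<open>rword r\<close> the
  encoded letters are compared, with the value at column \<open>k\<close> the letters of the word
  itself.\<close>

definition agree :: "nat \<Rightarrow> nat \<Rightarrow> (nat \<Rightarrow> 'b) \<Rightarrow> nat \<Rightarrow> nat \<Rightarrow> nat \<Rightarrow> bool" where
  "agree r k F l a a' \<longleftrightarrow> (\<forall>t<l. (a + t) mod r = k \<longrightarrow> F ((a + t) div r) = F ((a' + t) div r))"

lemma agree_sym: "a mod r = a' mod r \<Longrightarrow> agree r k F l a a' \<Longrightarrow> agree r k F l a' a"
  unfolding agree_def by (metis mod_add_left_eq)

lemma agree_shift:
  assumes "k < r"
  shows "agree r k F l a (a + r * M) \<longleftrightarrow> (\<forall>q. a \<le> r * q + k \<and> r * q + k < a + l \<longrightarrow> F q = F (q + M))"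
proof -
  have d: "(a + r * M + t) div r = (a + t) div r + M" for t
  proof -
    have "((a + t) + M * r) div r = M + (a + t) div r" using assms by (intro div_mult_self1) simp
    moreover have "a + r * M + t = (a + t) + M * r" by simp
    ultimately show ?thesis by presburger
  qed
  have "agree r k F l a (a + r * M) \<longleftrightarrow> (\<forall>t<l. (a + t) mod r = k \<longrightarrow> F ((a + t) div r) = F ((a + t) div r + M))"
    unfolding agree_def d ..
  also have "\<dots> \<longleftrightarrow> (\<forall>q. a \<le> r * q + k \<and> r * q + k < a + l \<longrightarrow> F q = F (q + M))"
  proof (intro iffI allI impI)
    fix q assume A: "\<forall>t<l. (a + t) mod r = k \<longrightarrow> F ((a + t) div r) = F ((a + t) div r + M)"
      and q: "a \<le> r * q + k \<and> r * q + k < a + l"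
    define t where "t = r * q + k - a"
    have "a + t = r * q + k" "t < l" using q by (auto simp: t_def)
    moreover have "(r * q + k) mod r = k" "(r * q + k) div r = q" using assms by simp_all
    ultimately show "F q = F (q + M)" using A by metis
  next
    fix t assume A: "\<forall>q. a \<le> r * q + k \<and> r * q + k < a + l \<longrightarrow> F q = F (q + M)"
      and t: "t < l" "(a + t) mod r = k"
    have "r * ((a + t) div r) + k = a + t" using t(2) by (metis mult_div_mod_eq)
    then show "F ((a + t) div r) = F ((a + t) div r + M)" using A t(1) by simp
  qed
  finally show ?thesis .
qed

text \<open>Contraction of a factor to column \<open>k\<close>: the blocks whose column
  \<open>k\<close> it meets are those from \<open>beta r k a\<close> to just before
  \<open>beta r k (a + l)\<close>.\<close>

lemma agree_beta:
  assumes k: "k < r" and m: "a mod r = a' mod r"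
  shows "agree r k F l a a' \<longleftrightarrow> (\<forall>t<beta r k (a + l) - beta r k a. F (beta r k a + t) = F (beta r k a' + t))"
proof -
  have *: "agree r k F l a (a + r * M) \<longleftrightarrow>
      (\<forall>t<beta r k (a + l) - beta r k a. F (beta r k a + t) = F (beta r k a + M + t))" for M a
  proof -
    have "agree r k F l a (a + r * M) \<longleftrightarrow>
        (\<forall>q. beta r k a \<le> q \<and> q < beta r k (a + l) \<longrightarrow> F q = F (q + M))"
      unfolding agree_shift[OF k] beta_le_iff[OF k] less_beta_iff[OF k] ..
    also have "\<dots> \<longleftrightarrow> (\<forall>t<beta r k (a + l) - beta r k a. F (beta r k a + t) = F (beta r k a + M + t))"
    proof (intro iffI allI impI)
      fix q assume A: "\<forall>t<beta r k (a + l) - beta r k a. F (beta r k a + t) = F (beta r k a + M + t)"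
        and q: "beta r k a \<le> q \<and> q < beta r k (a + l)"
      then obtain t where t: "q = beta r k a + t" using le_Suc_ex by blast
      then have "t < beta r k (a + l) - beta r k a" using q by simp
      then show "F q = F (q + M)" using A by (simp add: t ac_simps)
    next
      fix t assume A: "\<forall>q. beta r k a \<le> q \<and> q < beta r k (a + l) \<longrightarrow> F q = F (q + M)"
        and "t < beta r k (a + l) - beta r k a"
      then show "F (beta r k a + t) = F (beta r k a + M + t)"
        using A[rule_format, of "beta r k a + t"] by (simp add: ac_simps)
    qed
    finally show ?thesis .
  qed
  have r: "0 < r" using k by simp
  from m show ?thesis
  proof (cases rule: mod_eq_cases)
    case (1 M)
    then show ?thesis using *[of a M] by (simp add: beta_shift[OF r])
  next
    case (2 M)
    have "agree r k F l a a' \<longleftrightarrow> agree r k F l a' a" using agree_sym m by metis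
    moreover have "beta r k (a + l) - beta r k a = beta r k (a' + l) - beta r k a'"
      using gap_cong[OF m] by (simp add: beta_add[OF r])
    ultimately show ?thesis using *[of a' M] 2 by (auto simp: beta_shift[OF r])
  qed
qed

lemma beta_diff:
  assumes "0 < r" "a mod r = a' mod r"
  shows "beta r k (a + l) - beta r k a = beta r k (a' + l) - beta r k a'"
  using gap_cong[OF assms(2)] by (simp add: beta_add[OF assms(1)])

text \<open>
  A cut between the columns \<open>c\<close> and \<open>k\<close> of one block is encoded by the value at column \<open>k\<close> of this block.
  Both sides of the cut know this value if they reach to column \<open>k\<close> and to the pair of columns \<open>c\<close>,
  \<open>Suc c\<close>, respectively.
\<close>

definition sigma :: "nat \<Rightarrow> nat \<Rightarrow> nat \<Rightarrow> nat \<Rightarrow> nat" where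
  "sigma r c k n =
     (if beta r k n = beta r c n then if c < k then Suc r else 0
      else Suc (rval r (r * min (beta r c n) (beta r k n) + k)))"

lemma sigma_less: "0 < r \<Longrightarrow> sigma r c k n < r + 2"
  using rval_less[of r] by (auto simp: sigma_def intro: less_SucI)

lemma sigma_shift:
  "0 < r \<Longrightarrow> sigma r c k (n + r * M) =
     (if beta r k n = beta r c n then if c < k then Suc r else 0
      else Suc (rval r (r * (min (beta r c n) (beta r k n) + M) + k)))"
  by (simp add: sigma_def beta_shift min_add_distrib_left)

text \<open>Let \<open>k < c\<close>. A block cut between these columns at the left end has column
  \<open>c\<close> inside the factor, so \<open>BA\<close> determines its value. A block cut at the
  right end has column \<open>k\<close> but not \<open>c\<close> inside, so its code is exactly what
  \<open>BA\<close> leaves open. For \<open>c \<le> k\<close> the ends exchange roles.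
  \<open>NE\<close> ensures that the factor reaches these columns.\<close>

lemma sigma_agree:
  assumes c: "c < r" and k: "k < r" and m: "a mod r = a' mod r"
    and BA: "agree r c (rword r) l a a'"
    and NE: "beta r c a < beta r c (a + l) \<or> beta r k a < beta r k (a + l)"
  shows "k < c \<Longrightarrow> sigma r c k a = sigma r c k a'" (is "_ \<Longrightarrow> ?P1 a a'")
    and "c \<le> k \<Longrightarrow> sigma r c k (a + l) = sigma r c k (a' + l)" (is "_ \<Longrightarrow> ?P2 a a'")
    and "k < c \<Longrightarrow> sigma r c k (a + l) = sigma r c k (a' + l) \<longleftrightarrow>
      agree r k (\<lambda>q. rval r (r * q + k)) l a a'" (is "_ \<Longrightarrow> ?P3 a a'")
    and "c \<le> k \<Longrightarrow> sigma r c k a = sigma r c k a' \<longleftrightarrow>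
      agree r k (\<lambda>q. rval r (r * q + k)) l a a'" (is "_ \<Longrightarrow> ?P4 a a'")
proof -
  have r: "0 < r" using c by simp
  \<comment> \<open>Shifts to the right by a multiple of \<open>r\<close> suffice, because the
    claims are symmetric in \<open>a\<close> and \<open>a'\<close>.\<close>
  have "(k < c \<longrightarrow> ?P1 a a' \<and> ?P3 a a') \<and> (c \<le> k \<longrightarrow> ?P2 a a' \<and> ?P4 a a')"
    if a': "a' = a + r * M" and BA: "agree r c (rword r) l a a'"
      and NE: "beta r c a < beta r c (a + l) \<or> beta r k a < beta r k (a + l)" for a a' M
  proof -
    let ?b = "a + l"
    have b': "a' + l = ?b + r * M" by (simp add: a')
    have BA: "rval r (r * q + k) = rval r (r * (q + M) + k)"
      if "beta r c a \<le> q" "q < beta r c ?b" for q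
      using BA that rval_cong[OF k] unfolding a' agree_shift[OF c] beta_le_iff[OF c] less_beta_iff[OF c] by blast
    have LA: "agree r k (\<lambda>q. rval r (r * q + k)) l a a' \<longleftrightarrow>
        (\<forall>q. beta r k a \<le> q \<and> q < beta r k ?b \<longrightarrow> rval r (r * q + k) = rval r (r * (q + M) + k))"
      unfolding a' agree_shift[OF k] beta_le_iff[OF k] less_beta_iff[OF k] ..
    note le_Suc = beta_le_Suc[OF c k] beta_le_Suc[OF k c]
    show ?thesis
    proof (intro conjI impI)
      assume kc: "k < c"
      have le: "beta r c n \<le> beta r k n" for n using beta_antimono[of k c r] kc c by simp
      show "?P1 a a'"
        unfolding a' sigma_shift[OF r] unfolding sigma_def
        using BA[of "beta r c a"] le[of a] le_Suc(1)[of a] le_Suc(1)[of ?b] NE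
        by (auto simp: min_def)
      show "?P3 a a'"
        unfolding LA unfolding b' sigma_shift[OF r] unfolding sigma_def
      proof (intro iffI allI impI)
        fix q assume q: "beta r k a \<le> q \<and> q < beta r k ?b"
          and eq: "(if beta r k ?b = beta r c ?b then if c < k then Suc r else 0
            else Suc (rval r (r * min (beta r c ?b) (beta r k ?b) + k))) =
           (if beta r k ?b = beta r c ?b then if c < k then Suc r else 0
            else Suc (rval r (r * (min (beta r c ?b) (beta r k ?b) + M) + k)))"
        show "rval r (r * q + k) = rval r (r * (q + M) + k)"
        proof (cases "q < beta r c ?b")
          case True
          then show ?thesis using BA[of q] q le[of a] by simp
        next
          case False
          then have "q = beta r c ?b" "beta r k ?b \<noteq> beta r c ?b" "min (beta r c ?b) (beta r k ?b) = q"
            using q le_Suc(1)[of ?b] by auto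
          then show ?thesis using eq by simp
        qed
      next
        assume LA: "\<forall>q. beta r k a \<le> q \<and> q < beta r k ?b \<longrightarrow> rval r (r * q + k) = rval r (r * (q + M) + k)"
        show "(if beta r k ?b = beta r c ?b then if c < k then Suc r else 0
            else Suc (rval r (r * min (beta r c ?b) (beta r k ?b) + k))) =
           (if beta r k ?b = beta r c ?b then if c < k then Suc r else 0
            else Suc (rval r (r * (min (beta r c ?b) (beta r k ?b) + M) + k)))"
          using LA[rule_format, of "beta r c ?b"] le[of ?b] le_Suc(1)[of a] le_Suc(1)[of ?b] NE
          by (auto simp: min_def)
      qed
    next
      assume ck: "c \<le> k"
      have le: "beta r k n \<le> beta r c n" for n using beta_antimono[of c k r] ck k by simp
      show "?P2 a a'"
        unfolding b' sigma_shift[OF r] unfolding sigma_def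
        using BA[of "beta r k ?b"] le[of ?b] le_Suc(2)[of a] le_Suc(2)[of ?b] NE
        by (auto simp: min_def)
      show "?P4 a a'"
        unfolding LA unfolding a' sigma_shift[OF r] unfolding sigma_def
      proof (intro iffI allI impI)
        fix q assume q: "beta r k a \<le> q \<and> q < beta r k ?b"
          and eq: "(if beta r k a = beta r c a then if c < k then Suc r else 0
            else Suc (rval r (r * min (beta r c a) (beta r k a) + k))) =
           (if beta r k a = beta r c a then if c < k then Suc r else 0
            else Suc (rval r (r * (min (beta r c a) (beta r k a) + M) + k)))"
        show "rval r (r * q + k) = rval r (r * (q + M) + k)"
        proof (cases "beta r c a \<le> q")
          case True
          then show ?thesis using BA[of q] q le[of ?b] by simp
        next
          case False
          then have "q = beta r k a" "beta r k a \<noteq> beta r c a" "min (beta r c a) (beta r k a) = q"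
            using q le_Suc(2)[of a] by auto
          then show ?thesis using eq by simp
        qed
      next
        assume LA: "\<forall>q. beta r k a \<le> q \<and> q < beta r k ?b \<longrightarrow> rval r (r * q + k) = rval r (r * (q + M) + k)"
        show "(if beta r k a = beta r c a then if c < k then Suc r else 0
            else Suc (rval r (r * min (beta r c a) (beta r k a) + k))) =
           (if beta r k a = beta r c a then if c < k then Suc r else 0
            else Suc (rval r (r * (min (beta r c a) (beta r k a) + M) + k)))"
          using LA[rule_format, of "beta r k a"] le[of a] le_Suc(2)[of a] le_Suc(2)[of ?b] NE
          by (auto simp: min_def)
      qed
    qed
  qed
  note shift = this
  have "(k < c \<longrightarrow> ?P1 a a' \<and> ?P3 a a') \<and> (c \<le> k \<longrightarrow> ?P2 a a' \<and> ?P4 a a')"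
    using m
  proof (cases rule: mod_eq_cases)
    case (1 M)
    then show ?thesis using shift[OF _ BA NE] by blast
  next
    case (2 M)
    have "beta r c a' < beta r c (a' + l) \<or> beta r k a' < beta r k (a' + l)"
      using NE beta_diff[OF r m, of c l] beta_diff[OF r m, of k l] by linarith
    then have *: "(k < c \<longrightarrow> ?P1 a' a \<and> ?P3 a' a) \<and> (c \<le> k \<longrightarrow> ?P2 a' a \<and> ?P4 a' a)"
      using shift[OF 2 agree_sym[OF m BA]] by blast
    have "agree r k F l a' a \<longleftrightarrow> agree r k F l a a'" for F :: "nat \<Rightarrow> nat"
      using agree_sym m by metis
    then show ?thesis
      using * unfolding eq_commute[of "sigma r c k a'" "sigma r c k a"]
        eq_commute[of "sigma r c k (a' + l)" "sigma r c k (a + l)"] by (simp only:)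
  qed
  then show "k < c \<Longrightarrow> ?P1 a a'" "c \<le> k \<Longrightarrow> ?P2 a a'" "k < c \<Longrightarrow> ?P3 a a'" "c \<le> k \<Longrightarrow> ?P4 a a'"
    by blast+
qed

section \<open>Transfer of interval systems to the infinite Zimin word\<close>

lemma agree_rval_iff:
  assumes m: "a mod r = a' mod r"
  shows "agree r k (\<lambda>q. rval r (r * q + k)) l a a' \<longleftrightarrow>
    (\<forall>t<l. (a + t) mod r = k \<longrightarrow> rword r (a + t) = rword r (a' + t))"
proof -
  have "rval r (r * ((a + t) div r) + k) = rval r (r * ((a' + t) div r) + k) \<longleftrightarrow>
      rword r (a + t) = rword r (a' + t)" if t: "(a + t) mod r = k" for t
  proof -
    have m': "(a + t) mod r = (a' + t) mod r" using m by (metis mod_add_left_eq)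
    then have "r * ((a + t) div r) + k = a + t" "r * ((a' + t) div r) + k = a' + t"
      using t by (metis mult_div_mod_eq)+
    then show ?thesis using m' by (simp add: rword_def)
  qed
  then show ?thesis unfolding agree_def by blast
qed

text \<open>The default codes are chosen for this. For \<open>c < k\<close> the code is at most
  \<open>r\<close> until column \<open>k\<close> has been passed and then \<open>Suc r\<close>;
  otherwise it is \<open>0\<close> first and positive after column \<open>k\<close>.\<close>

lemma sigma_mono:
  assumes c: "c < r" and k: "k < r" and n: "n \<le> n'" and eq: "beta r c n = beta r c n'"
  shows "sigma r c k n \<le> sigma r c k n'"
    and "beta r k n \<noteq> beta r k n' \<Longrightarrow> sigma r c k n < sigma r c k n'"
proof -
  have r: "0 < r" using c by simp
  have mono: "beta r k n \<le> beta r k n'" by (rule beta_mono[OF n])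
  have le: "beta r c m \<le> Suc (beta r k m)" "beta r k m \<le> Suc (beta r c m)" for m
    using beta_le_Suc c k by blast+
  have *: "sigma r c k n \<le> sigma r c k n' \<and> (beta r k n \<noteq> beta r k n' \<longrightarrow> sigma r c k n < sigma r c k n')"
  proof (cases "beta r k n = beta r k n'")
    case True
    then show ?thesis using eq by (simp add: sigma_def)
  next
    case False
    show ?thesis
    proof (cases "c < k")
      case True
      have "beta r k m \<le> beta r c m" for m using beta_antimono[of c k r] True k by simp
      then have "beta r k n \<noteq> beta r c n" "beta r k n' = beta r c n'"
        using le(1)[of n] le(1)[of n'] mono False eq by (metis le_antisym le_SucE not_less_eq_eq)+
      then show ?thesis using True rval_less[OF r] by (simp add: sigma_def less_imp_le)
    next
      case False': False
      have "beta r c m \<le> beta r k m" for m using beta_antimono[of k c r] False' c by simp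
      then have "beta r k n = beta r c n" "beta r k n' \<noteq> beta r c n'"
        using le(2)[of n] le(2)[of n'] mono False eq by (metis le_antisym le_SucE not_less_eq_eq)+
      then show ?thesis using False' by (simp add: sigma_def)
    qed
  qed
  show "sigma r c k n \<le> sigma r c k n'"
    and "beta r k n \<noteq> beta r k n' \<Longrightarrow> sigma r c k n < sigma r c k n'"
    using * by blast+
qed

lemma eq_of_beta_gap: "beta r c n = beta r c n' \<Longrightarrow> gap r c n = gap r c n' \<Longrightarrow> n = n'"
  using beta_gap[of n r c] beta_gap[of n' r c] by simp

text \<open>The gaps give the column of each start, the track \<open>b\<close> the letters of the
  blocks, and the codes \<open>sigma\<close> supply the rest by \<open>sigma_agree\<close>. For
  \<open>c \<le> k\<close> this lemma passes agreement on from the left end of an interval to the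
  right end, in the order of the list; for \<open>k < c\<close> it goes the other way.\<close>

lemma track_letters:
  assumes c: "c < r" and k: "k < r"
    and le: "\<And>a b. (a, b) \<in> set v \<Longrightarrow> a \<le> b"
    and f: "\<And>a b. (a, b) \<in> set v \<Longrightarrow> f a < f b \<longleftrightarrow> beta r c a < beta r c b \<or> beta r k a < beta r k b"
    and g: "itrack (\<lambda>x. x) (gap r c) v (gap r c n) (gap r c e)"
    and b: "track (\<lambda>x y. rword r x = rword r y) (beta r c) v (beta r c n) (beta r c e)"
    and s: "itrack f (sigma r c k) v (sigma r c k n) (sigma r c k e)"
  shows "track (\<lambda>x y. x mod r = k \<longrightarrow> rword r x = rword r y) (\<lambda>x. x) v n e"
proof -
  have r: "0 < r" using c by simp
  let ?g = "gap r c" and ?b = "beta r c" and ?s = "sigma r c k"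
  let ?T = "track (\<lambda>x y. x mod r = k \<longrightarrow> rword r x = rword r y) (\<lambda>x. x)"
  have step: "?g (n + (b - a)) = ?g b \<and> ?b (n + (b - a)) = ?b n + (?b b - ?b a) \<and> n mod r = a mod r \<and>
      agree r c (rword r) (b - a) n a"
    if ab: "a \<le> b" "?g n = ?g a" "\<forall>t<?b b - ?b a. rword r (?b n + t) = rword r (?b a + t)" for n a b
  proof -
    have m: "n mod r = a mod r" by (rule gap_eq_imp[OF ab(2)])
    then have "(n + (b - a)) mod r = (a + (b - a)) mod r" by (metis mod_add_left_eq)
    then have "?g (n + (b - a)) = ?g b" using gap_cong[of "n + (b - a)" r b c] ab(1) by simp
    moreover have d: "?b (n + (b - a)) - ?b n = ?b b - ?b a"
      using beta_diff[OF r m, of c "b - a"] ab(1) by simp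
    have "?b n \<le> ?b (n + (b - a))" by (rule beta_mono) simp
    then have "?b (n + (b - a)) = ?b n + (?b b - ?b a)" using d by linarith
    moreover have "agree r c (rword r) (b - a) n a"
      unfolding agree_beta[OF c m] d using ab(3) by blast
    ultimately show ?thesis using m by blast
  qed
  show ?thesis
  proof (cases "c \<le> k")
    case True
    show ?thesis using le f g b s
    proof (induction v arbitrary: n)
      case Nil
      then show ?case using eq_of_beta_gap by simp
    next
      case (Cons p v)
      obtain a b where p: "p = (a, b)" by (cases p)
      have ab: "a \<le> b" using Cons.prems(1) p by simp
      show ?case
      proof (cases "a = b")
        case True
        have "?T v n e" by (rule Cons.IH) (use Cons.prems True p in auto)
        then show ?thesis by (simp add: p True)
      next
        case False
        let ?n = "n + (b - a)"
        have ga: "?g n = ?g a" and gv: "itrack (\<lambda>x. x) ?g v (?g b) (?g e)"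
          and bh: "\<forall>t<?b b - ?b a. rword r (?b n + t) = rword r (?b a + t)"
          and bv: "track (\<lambda>x y. rword r x = rword r y) ?b v (?b n + (?b b - ?b a)) (?b e)"
          using Cons.prems(3,4) False ab by (auto simp: p)
        note st = step[OF ab ga bh]
        note m = conjunct1[OF conjunct2[OF conjunct2[OF st]]]
        have iff: "f a < f b \<longleftrightarrow> ?b n < ?b ?n \<or> beta r k n < beta r k ?n"
        proof -
          have "?b ?n - ?b n = ?b b - ?b a" "beta r k ?n - beta r k n = beta r k b - beta r k a"
            using beta_diff[OF r m, of _ "b - a"] ab by simp_all
          then show ?thesis using Cons.prems(2)[of a b] p by auto
        qed
        show ?thesis
        proof (cases "f a < f b")
          case fab: True
          then have sa: "?s n = ?s a" and sv: "itrack f ?s v (?s b) (?s e)"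
            using Cons.prems(5) by (auto simp: p)
          note sg = sigma_agree[OF c k m conjunct2[OF conjunct2[OF conjunct2[OF st]]] iff[THEN iffD1, OF fab]]
          have "?s ?n = ?s b" using sg(2)[OF \<open>c \<le> k\<close>] ab by simp
          then have "?T v ?n e" by (intro Cons.IH) (use Cons.prems gv bv sv st in auto)
          moreover have "agree r k (\<lambda>q. rval r (r * q + k)) (b - a) n a"
            using sg(4)[OF \<open>c \<le> k\<close>] sa by simp
          ultimately show ?thesis by (simp add: p agree_rval_iff[OF m])
        next
          case fab: False
          then have sv: "itrack f ?s v (?s n) (?s e)" using Cons.prems(5) by (auto simp: p)
          have e: "?b ?n = ?b n" "beta r k ?n = beta r k n"
            using fab iff beta_mono[of n ?n r] by (simp_all add: le_antisym not_less)
          then have "?s ?n = ?s n" by (simp add: sigma_def)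
          then have "?T v ?n e" by (intro Cons.IH) (use Cons.prems gv bv sv st in auto)
          moreover have "agree r k (\<lambda>q. rval r (r * q + k)) (b - a) n a"
            unfolding agree_beta[OF k m] using e by simp
          ultimately show ?thesis by (simp add: p agree_rval_iff[OF m])
        qed
      qed
    qed
  next
    case False
    then have kc: "k < c" by simp
    \<comment> \<open>Here the code at the current point is known only from the tail, so the start
      index is generalized to \<open>i\<close> and identified by the induction.\<close>
    have "?T v n e \<and> i = ?s n" if "itrack f ?s v i (?s e)" for i
      using le f g b that
    proof (induction v arbitrary: n i)
      case Nil
      then show ?case using eq_of_beta_gap[of r c n e] by simp
    next
      case (Cons p v)
      obtain a b where p: "p = (a, b)" by (cases p)
      have ab: "a \<le> b" using Cons.prems(1) p by simp
      show ?case
      proof (cases "a = b")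
        case True
        have "?T v n e \<and> i = ?s n" by (rule Cons.IH) (use Cons.prems True p in auto)
        then show ?thesis by (simp add: p True)
      next
        case False
        let ?n = "n + (b - a)"
        have ga: "?g n = ?g a" and gv: "itrack (\<lambda>x. x) ?g v (?g b) (?g e)"
          and bh: "\<forall>t<?b b - ?b a. rword r (?b n + t) = rword r (?b a + t)"
          and bv: "track (\<lambda>x y. rword r x = rword r y) ?b v (?b n + (?b b - ?b a)) (?b e)"
          using Cons.prems(3,4) False ab by (auto simp: p)
        note st = step[OF ab ga bh]
        note m = conjunct1[OF conjunct2[OF conjunct2[OF st]]]
        have iff: "f a < f b \<longleftrightarrow> ?b n < ?b ?n \<or> beta r k n < beta r k ?n"
        proof -
          have "?b ?n - ?b n = ?b b - ?b a" "beta r k ?n - beta r k n = beta r k b - beta r k a"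
            using beta_diff[OF r m, of _ "b - a"] ab by simp_all
          then show ?thesis using Cons.prems(2)[of a b] p by auto
        qed
        show ?thesis
        proof (cases "f a < f b")
          case fab: True
          then have sa: "i = ?s a" and sv: "itrack f ?s v (?s b) (?s e)"
            using Cons.prems(5) by (auto simp: p)
          note sg = sigma_agree[OF c k m conjunct2[OF conjunct2[OF conjunct2[OF st]]] iff[THEN iffD1, OF fab]]
          have IH: "?T v ?n e \<and> ?s b = ?s ?n" by (intro Cons.IH) (use Cons.prems gv bv sv st in auto)
          moreover have "?s n = ?s a" using sg(1)[OF kc] .
          moreover have "agree r k (\<lambda>q. rval r (r * q + k)) (b - a) n a"
            using sg(3)[OF kc] IH ab by simp
          ultimately show ?thesis using sa by (simp add: p agree_rval_iff[OF m])
        next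
          case fab: False
          then have sv: "itrack f ?s v i (?s e)" using Cons.prems(5) by (auto simp: p)
          have e: "?b ?n = ?b n" "beta r k ?n = beta r k n"
            using fab iff beta_mono[of n ?n r] by (simp_all add: le_antisym not_less)
          then have "?s ?n = ?s n" by (simp add: sigma_def)
          moreover have "?T v ?n e \<and> i = ?s ?n" by (intro Cons.IH) (use Cons.prems gv bv sv st in auto)
          moreover have "agree r k (\<lambda>q. rval r (r * q + k)) (b - a) n a"
            unfolding agree_beta[OF k m] using e by simp
          ultimately show ?thesis by (simp add: p agree_rval_iff[OF m])
        qed
      qed
    qed
    then show ?thesis using s by blast
  qed
qed

text \<open>
  The boundaries \<open>B\<close> and the labelled intervals \<open>I\<close> come from several factorizations of the same factor
  \<open>[s, e)\<close> of the word.
\<close>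

definition interval_system ::
  "nat \<Rightarrow> 'x set \<Rightarrow> nat set \<Rightarrow> (nat \<times> nat \<times> 'x) set \<Rightarrow> nat \<Rightarrow> nat \<Rightarrow> bool" where
  "interval_system r X B I s e \<longleftrightarrow> finite X \<and> card X + 3 \<le> r \<and> s \<in> B \<and> e \<in> B \<and> B \<subseteq> {s..e} \<and>
     (\<forall>i j x. (i, j, x) \<in> I \<longrightarrow> i \<in> B \<and> j \<in> B \<and> i \<le> j \<and> x \<in> X) \<and>
     (\<forall>i j i' j' x. (i, j, x) \<in> I \<longrightarrow> (i', j', x) \<in> I \<longrightarrow>
        j - i = j' - i' \<and> (\<forall>t<j - i. rword r (i + t) = rword r (i' + t))) \<and>
     (\<forall>n\<in>B. n < e \<longrightarrow> (\<exists>j x. (n, j, x) \<in> I \<and> n < j))"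

definition same_image :: "(nat \<Rightarrow> nat) \<Rightarrow> nat \<Rightarrow> nat \<Rightarrow> nat \<Rightarrow> nat \<Rightarrow> bool" where
  "same_image f i j i' j' \<longleftrightarrow> f j - f i = f j' - f i' \<and>
     (\<forall>t<f j - f i. zimin_inf (f i + t) = zimin_inf (f i' + t))"

text \<open>Such an \<open>f\<close> moves the boundaries into the infinite Zimin word and turns
  each label into one factor of it: a substitution given by positions.\<close>

definition realizes :: "nat set \<Rightarrow> (nat \<times> nat \<times> 'x) set \<Rightarrow> (nat \<Rightarrow> nat) \<Rightarrow> bool" where
  "realizes B I f \<longleftrightarrow> strict_mono_on B f \<and>
     (\<forall>i j i' j' x. (i, j, x) \<in> I \<longrightarrow> (i', j', x) \<in> I \<longrightarrow> same_image f i j i' j')"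

lemma same_image_cut:
  assumes f: "\<And>n. f n = zimin_cut K (g n) (\<iota> n)" and g: "same_image g i j i' j'" "g i \<le> g j" "g i' \<le> g j'"
    and f_le: "f i \<le> f j" "f i' \<le> f j'"
    and \<iota>: "\<iota> i = \<iota> i'" "\<iota> j = \<iota> j'" "\<iota> j < K"
  shows "same_image f i j i' j'"
proof -
  have "f i' + (f j - f i) = zimin_cut K (g i' + (g j - g i)) (\<iota> j)"
    using cut_diff[OF g(2)] f_le(1) by (simp add: f \<iota>(1))
  also have "g i' + (g j - g i) = g j'" using g by (simp add: same_image_def)
  finally have "f i' + (f j - f i) = f j'" using \<iota>(2) by (simp add: f)
  moreover have "zimin_inf (f i + t) = zimin_inf (f i' + t)" if "t < f j - f i" for t
    using cut_agree[OF g(2) _ \<iota>(3), of "g i'" t "\<iota> i"] g(1) that by (simp add: f \<iota>(1) same_image_def)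
  ultimately show ?thesis unfolding same_image_def using f_le by simp
qed

lemma itrack_cong:
  "(\<And>a b. (a, b) \<in> set v \<Longrightarrow> f a < f b \<longleftrightarrow> g a < g b) \<Longrightarrow> itrack f \<iota> v i j = itrack g \<iota> v i j"
proof (induction v arbitrary: i)
  case (Cons p v)
  then show ?case by (cases p) auto
qed simp

text \<open>Each boundary before \<open>e\<close> starts a nonempty interval, and nonempty intervals
  with one label start in one column. So the boundaries occupy at most \<open>card X + 1\<close>
  columns, fewer than the \<open>r - 1\<close> columns \<open>1, ..., r - 1\<close>; a free one is
  \<open>Suc c\<close>.\<close>

lemma interval_system_column:
  assumes "interval_system r X B I s e"
  obtains c where "Suc c < r" "\<And>n. n \<in> B \<Longrightarrow> gap r c n \<noteq> 0"
proof -
  note S = assms[unfolded interval_system_def]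
  define col where "col x = (SOME m. \<exists>i j. (i, j, x) \<in> I \<and> i < j \<and> m = i mod r)" for x
  have col: "i mod r = col x" if ij: "(i, j, x) \<in> I" "i < j" for i j x
  proof -
    have "\<exists>i j. (i, j, x) \<in> I \<and> i < j \<and> col x = i mod r"
      unfolding col_def by (rule someI[of _ "i mod r"]) (use ij in blast)
    then obtain i' j' where ij': "(i', j', x) \<in> I" "i' < j'" "col x = i' mod r" by blast
    have "\<forall>t<j - i. rword r (i + t) = rword r (i' + t)" using S ij(1) ij'(1) by blast
    then have "rword r (i + 0) = rword r (i' + 0)" using ij(2) by fastforce
    then show ?thesis using ij' by (simp add: rword_def)
  qed
  have "(\<lambda>n. n mod r) ` B \<subseteq> insert (e mod r) (col ` X)"
  proof (rule image_subsetI)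
    fix n assume n: "n \<in> B"
    show "n mod r \<in> insert (e mod r) (col ` X)"
    proof (cases "n < e")
      case True
      then obtain j x where "(n, j, x) \<in> I" "n < j" using S n by blast
      moreover from this have "x \<in> X" using S by blast
      ultimately show ?thesis using col by blast
    next
      case False
      then have "n = e" using S n by force
      then show ?thesis by simp
    qed
  qed
  then have "card ((\<lambda>n. n mod r) ` B) \<le> card (insert (e mod r) (col ` X))"
    using S by (intro card_mono) auto
  also have "\<dots> \<le> Suc (card X)" using S card_image_le[of X col] by (intro order.trans[OF card_insert_le_m1]) auto
  also have "\<dots> < card {1..<r}"
  proof -
    have "card X + 3 \<le> r" using S by blast
    then show ?thesis by simp
  qed
  finally have "\<not> {1..<r} \<subseteq> (\<lambda>n. n mod r) ` B"
    using card_mono[of "(\<lambda>n. n mod r) ` B" "{1..<r}"] finite_subset[of B "{s..e}"] S by auto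
  then obtain m where m: "m \<in> {1..<r}" "m \<notin> (\<lambda>n. n mod r) ` B" by blast
  then obtain c where c: "m = Suc c" by (cases m) auto
  have "gap r c n \<noteq> 0" if "n \<in> B" for n
  proof
    assume "gap r c n = 0"
    then have "m = n mod r" using gap_eq_0_iff[of c r n] m(1) by (simp add: c)
    then show False using m(2) that by blast
  qed
  then show thesis using that m(1) c by simp
qed

section \<open>Contraction to a pair of columns that no boundary separates\<close>

context
  fixes r :: nat and X :: "'x set" and B I s e c
  assumes S: "interval_system r X B I s e" and c: "Suc c < r"
    and gap: "\<And>n. n \<in> B \<Longrightarrow> gap r c n \<noteq> 0"
begin

abbreviation (input) "\<beta> \<equiv> beta r c"
abbreviation (input) "\<gamma> \<equiv> gap r c"

lemma r_pos: "0 < r" and c_less: "c < r"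
  using c by auto

lemma intervalD: "(i, j, x) \<in> I \<Longrightarrow> i \<in> B \<and> j \<in> B \<and> i \<le> j \<and> x \<in> X"
  using S unfolding interval_system_def by blast

lemma interval_mod:
  assumes "(i, j, x) \<in> I" "(i', j', x) \<in> I" "i < j"
  shows "i mod r = i' mod r" "j = i + (j - i)" "j' = i' + (j - i)" "i' < j'"
    "\<forall>t<j - i. rword r (i + t) = rword r (i' + t)"
proof -
  have *: "j - i = j' - i' \<and> (\<forall>t<j - i. rword r (i + t) = rword r (i' + t))"
    using S assms unfolding interval_system_def by blast
  then have "rword r (i + 0) = rword r (i' + 0)" using assms(3) by fastforce
  then show "i mod r = i' mod r" by (simp add: rword_def)
  show "j = i + (j - i)" "j' = i' + (j - i)" "i' < j'"
    "\<forall>t<j - i. rword r (i + t) = rword r (i' + t)"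
    using * assms intervalD by auto
qed

text \<open>An interval that contains a position of column \<open>c\<close> contains the next
  position too, as no boundary separates the pair; the two letters determine the letter of the
  block.\<close>

lemma interval_agree:
  assumes ij: "(i, j, x) \<in> I" "(i', j', x) \<in> I" "i < j"
  shows "agree r c (rword r) (j - i) i i'"
  unfolding agree_def
proof (intro allI impI)
  fix t assume t: "t < j - i" "(i + t) mod r = c"
  note m = interval_mod[OF ij]
  have t': "(i' + t) mod r = c" using t(2) m(1) by (metis mod_add_left_eq)
  have "Suc t \<noteq> j - i"
  proof
    assume "Suc t = j - i"
    then have j: "j = Suc (i + t)" using ij(3) by simp
    have "j mod r = Suc c" unfolding j using t(2) c by (simp add: mod_Suc)
    then show False using gap[of j] intervalD[OF ij(1)] gap_eq_0_iff[OF c] by simp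
  qed
  then have "rword r (i + t) = rword r (i' + t)" "rword r (i + Suc t) = rword r (i' + Suc t)"
    using m(5)[rule_format, of t] m(5)[rule_format, of "Suc t"] t(1) by simp_all
  moreover have "i + t = r * ((i + t) div r) + c" "i' + t = r * ((i' + t) div r) + c"
    using t(2) t' by (metis mult_div_mod_eq)+
  moreover have "i + Suc t = r * ((i + t) div r) + Suc c" "i' + Suc t = r * ((i' + t) div r) + Suc c"
    using calculation(3,4) by (metis add_Suc_right)+
  ultimately show "rword r ((i + t) div r) = rword r ((i' + t) div r)"
    using rword_decode[OF c] by metis
qed

lemma interval_system_beta:
  "interval_system r X (\<beta> ` B) ((\<lambda>(i, j, x). (\<beta> i, \<beta> j, x)) ` I) (\<beta> s) (\<beta> e)"
proof -
  have agr: "\<beta> j - \<beta> i = \<beta> j' - \<beta> i' \<and> (\<forall>t<\<beta> j - \<beta> i. rword r (\<beta> i + t) = rword r (\<beta> i' + t))"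
    if ij: "(i, j, x) \<in> I" "(i', j', x) \<in> I" for i j i' j' x
  proof (cases "i < j")
    case True
    note m = interval_mod[OF ij True]
    show ?thesis
      using beta_diff[OF r_pos m(1), of c "j - i"] interval_agree[OF ij True]
        m(2,3) agree_beta[OF c_less m(1), of "rword r" "j - i"] by simp
  next
    case False
    have "\<not> i' < j'" using False interval_mod(4)[OF ij(2,1)] by blast
    then show ?thesis using False intervalD[OF ij(1)] intervalD[OF ij(2)] by simp
  qed
  have next_ex: "\<exists>j x. (\<beta> n, j, x) \<in> (\<lambda>(i, j, x). (\<beta> i, \<beta> j, x)) ` I \<and> \<beta> n < j"
    if n: "n \<in> B" "\<beta> n < \<beta> e" for n
  proof -
    \<comment> \<open>Of the boundaries contracted to the same point, the last one starts an
      interval that remains nonempty.\<close>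
    let ?N = "{m \<in> B. \<beta> m = \<beta> n}"
    have "finite B" using S finite_subset[of B "{s..e}"] unfolding interval_system_def by auto
    then have "Max ?N \<in> ?N" using n by (intro Max_in) auto
    then have M: "Max ?N \<in> B" "\<beta> (Max ?N) = \<beta> n" by auto
    have "Max ?N < e" using M n(2) beta_mono[of e "Max ?N" r c] by linarith
    then obtain j x where j: "(Max ?N, j, x) \<in> I" "Max ?N < j"
      using S M(1) unfolding interval_system_def by blast
    have "\<beta> j \<noteq> \<beta> n"
    proof
      assume "\<beta> j = \<beta> n"
      then have "j \<in> ?N" using intervalD[OF j(1)] by simp
      then have "j \<le> Max ?N" using \<open>finite B\<close> by (intro Max_ge) auto
      then show False using j(2) by simp
    qed
    then have "\<beta> n < \<beta> j" using beta_mono[of "Max ?N" j r c] j(2) M(2) by simp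
    moreover have "(\<beta> n, \<beta> j, x) \<in> (\<lambda>(i, j, x). (\<beta> i, \<beta> j, x)) ` I"
      using j(1) M(2) by (intro image_eqI[of _ _ "(Max ?N, j, x)"]) auto
    ultimately show ?thesis by blast
  qed
  have B: "s \<in> B" "e \<in> B" "B \<subseteq> {s..e}" "finite X" "card X + 3 \<le> r"
    using S unfolding interval_system_def by auto
  show ?thesis
    unfolding interval_system_def
  proof (intro conjI allI impI ballI)
    show "\<beta> ` B \<subseteq> {\<beta> s..\<beta> e}" using B(3) by (auto intro!: beta_mono)
  next
    fix i j x assume "(i, j, x) \<in> (\<lambda>(i, j, x). (\<beta> i, \<beta> j, x)) ` I"
    then obtain i0 j0 where "(i0, j0, x) \<in> I" "i = \<beta> i0" "j = \<beta> j0" by auto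
    then show "i \<in> \<beta> ` B" "j \<in> \<beta> ` B" "i \<le> j" "x \<in> X"
      using intervalD[of i0 j0 x] beta_mono[of i0 j0 r c] by simp_all
  next
    fix i j i' j' x
    assume "(i, j, x) \<in> (\<lambda>(i, j, x). (\<beta> i, \<beta> j, x)) ` I"
    then obtain i0 j0 where 1: "(i0, j0, x) \<in> I" "i = \<beta> i0" "j = \<beta> j0" by auto
    assume "(i', j', x) \<in> (\<lambda>(i, j, x). (\<beta> i, \<beta> j, x)) ` I"
    then obtain i1 j1 where 2: "(i1, j1, x) \<in> I" "i' = \<beta> i1" "j' = \<beta> j1" by auto
    note * = agr[OF 1(1) 2(1), folded 1(2,3) 2(2,3)]
    show "j - i = j' - i'" using * by blast
    show "rword r (i + t) = rword r (i' + t)" if "t < j - i" for t using * that by blast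
  qed (use B next_ex in auto)
qed

text \<open>\<open>beta\<close> grows by at most one per position, and not at the last position
  before \<open>e\<close>, since the gap at \<open>e\<close> is not zero. This makes the induction
  in \<open>transfer\<close> descend.\<close>

lemma beta_length_less: "s < e \<Longrightarrow> \<beta> e - \<beta> s < e - s"
proof -
  assume se: "s < e"
  have 1: "\<beta> (Suc n) \<le> Suc (\<beta> n)" for n
  proof -
    have "n \<le> r * \<beta> n + c" using beta_le_iff[OF c_less] by blast
    then have "Suc n \<le> r * Suc (\<beta> n) + c" using c by simp
    then show ?thesis using beta_le_iff[OF c_less] by blast
  qed
  have le: "\<beta> (n + l) \<le> \<beta> n + l" for n l
    by (induction l) (use 1 order_trans in \<open>fastforce+\<close>)
  obtain d where d: "e = Suc d" using se by (cases e) auto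
  have "e \<in> B" using S unfolding interval_system_def by blast
  then have "gap r c (Suc d) \<noteq> 0" using gap d by blast
  then have "\<beta> (Suc d) = \<beta> d"
    unfolding gap_def beta_def by (simp add: mod_Suc div_Suc split: if_splits)
  moreover have "\<beta> (s + (d - s)) \<le> \<beta> s + (d - s)" by (rule le)
  ultimately show ?thesis using se d by simp
qed

section \<open>Lifting a realization of the contracted system\<close>

context
  fixes k f'
  assumes k: "k < r"
    and f': "realizes (\<beta> ` B) ((\<lambda>(i, j, x). (\<beta> i, \<beta> j, x)) ` I) f'"
begin

text \<open>The first of two nested encodings: a code below \<open>r + 2\<close> carries the value
  at column \<open>k\<close> of a block that is cut. \<open>outer\<close> adds a code below
  \<open>r\<close> for the column, which separates the boundaries that \<open>inner\<close> leaves
  together.\<close>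

definition inner :: "nat \<Rightarrow> nat" where
  "inner n = zimin_cut (r + 2) (f' (\<beta> n)) (sigma r c k n)"

definition outer :: "nat \<Rightarrow> nat" where
  "outer n = zimin_cut r (inner n) (\<gamma> n)"

lemma f'_mono:
  assumes "i \<in> B" "j \<in> B"
  shows "f' (\<beta> i) < f' (\<beta> j) \<longleftrightarrow> \<beta> i < \<beta> j" "f' (\<beta> i) = f' (\<beta> j) \<longleftrightarrow> \<beta> i = \<beta> j"
proof -
  have "strict_mono_on (\<beta> ` B) f'" using f' by (simp add: realizes_def)
  then show "f' (\<beta> i) < f' (\<beta> j) \<longleftrightarrow> \<beta> i < \<beta> j" "f' (\<beta> i) = f' (\<beta> j) \<longleftrightarrow> \<beta> i = \<beta> j"
    using assms by (auto simp: strict_mono_on_less strict_mono_on_eq)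
qed

lemma inner_mono:
  assumes "i \<in> B" "j \<in> B" "i \<le> j"
  shows "inner i \<le> inner j" "inner i < inner j \<longleftrightarrow> \<beta> i < \<beta> j \<or> beta r k i < beta r k j"
proof -
  have s: "sigma r c k n < r + 2" for n by (rule sigma_less[OF r_pos])
  have *: "inner i \<le> inner j \<and> (inner i < inner j \<longleftrightarrow> \<beta> i < \<beta> j \<or> beta r k i < beta r k j)"
  proof (cases "\<beta> i = \<beta> j")
    case True
    show ?thesis
    proof (cases "beta r k i = beta r k j")
      case eq: True
      then have "inner i = inner j" using True by (simp add: inner_def sigma_def)
      then show ?thesis using True eq by simp
    next
      case False
      then have "sigma r c k i < sigma r c k j" using sigma_mono(2)[OF c_less k assms(3) True] by blast
      then have "inner i < inner j" using cut_less_same True by (simp add: inner_def)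
      moreover have "beta r k i < beta r k j" using False beta_mono[OF assms(3), of r k] by simp
      ultimately show ?thesis by simp
    qed
  next
    case False
    then have "\<beta> i < \<beta> j" using beta_mono[OF assms(3), of r c] by simp
    then have "inner i < inner j" unfolding inner_def using f'_mono(1)[OF assms(1,2)] s by (intro cut_less) auto
    then show ?thesis using \<open>\<beta> i < \<beta> j\<close> by simp
  qed
  then show "inner i \<le> inner j" "inner i < inner j \<longleftrightarrow> \<beta> i < \<beta> j \<or> beta r k i < beta r k j" by blast+
qed

text \<open>Boundaries with the same inner cut have the same \<open>beta\<close>, and then by
  \<open>beta_gap\<close> their gaps are ordered as they are.\<close>

lemma outer_less:
  assumes "i \<in> B" "j \<in> B" "i < j"
  shows "outer i < outer j"
proof (cases "inner i < inner j")
  case True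
  then show ?thesis unfolding outer_def gap_def using r_pos by (intro cut_less) auto
next
  case False
  then have eq: "inner i = inner j" using inner_mono(1)[OF assms(1,2)] assms(3) by simp
  then have "f' (\<beta> i) = f' (\<beta> j)" unfolding inner_def using cut_eq_iff[OF sigma_less[OF r_pos] sigma_less[OF r_pos]] by blast
  then have "\<beta> i = \<beta> j" using f'_mono(2) assms by blast
  then have "\<gamma> i < \<gamma> j" using beta_gap[of i r c] beta_gap[of j r c] assms(3) by simp
  then show ?thesis using eq cut_less_same by (simp add: outer_def)
qed

text \<open>Intervals with one label agree in all letters, so by \<open>sigma_agree\<close> their
  codes coincide at both ends, and so do their gaps. Two applications of
  \<open>same_image_cut\<close> lift the equality of the contracted factors. An interval that meets
  neither column is empty under \<open>inner\<close>.\<close>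

lemma realizes_outer: "realizes B I outer"
proof -
  have "same_image outer i j i' j'" if ij: "(i, j, x) \<in> I" "(i', j', x) \<in> I" for i j i' j' x
  proof (cases "i < j")
    case False
    then have "i = j" "i' = j'" using ij intervalD interval_mod(4)[OF ij(2,1)] by (metis le_neq_implies_less)+
    then show ?thesis by (simp add: same_image_def)
  next
    case True
    note m = interval_mod[OF ij True]
    have B: "i \<in> B" "j \<in> B" "i' \<in> B" "j' \<in> B" "i \<le> j" "i' \<le> j'" using ij intervalD by auto
    have g: "same_image (f' \<circ> \<beta>) i j i' j'"
    proof -
      have "(\<beta> i, \<beta> j, x) \<in> (\<lambda>(i, j, x). (\<beta> i, \<beta> j, x)) ` I" "(\<beta> i', \<beta> j', x) \<in> (\<lambda>(i, j, x). (\<beta> i, \<beta> j, x)) ` I"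
        using ij by force+
      then have "same_image f' (\<beta> i) (\<beta> j) (\<beta> i') (\<beta> j')" using f' unfolding realizes_def by blast
      then show ?thesis by (simp add: same_image_def)
    qed
    have le: "(f' \<circ> \<beta>) i \<le> (f' \<circ> \<beta>) j" "(f' \<circ> \<beta>) i' \<le> (f' \<circ> \<beta>) j'"
      using f'_mono B beta_mono[of i j r c] beta_mono[of i' j' r c] by (metis comp_apply le_less)+
    have d: "beta r q j - beta r q i = beta r q j' - beta r q i'" for q
      using beta_diff[OF r_pos m(1), of q "j - i"] m(2,3) by simp
    have inner: "same_image inner i j i' j'"
    proof (cases "\<beta> i < \<beta> j \<or> beta r k i < beta r k j")
      case NE: True
      have "agree r k (\<lambda>q. rval r (r * q + k)) (j - i) i i'"
        using m(5) by (simp add: agree_rval_iff[OF m(1)])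
      moreover note sg = sigma_agree[OF c_less k m(1) interval_agree[OF ij True], folded m(2,3), OF NE]
      ultimately have "sigma r c k i = sigma r c k i'" "sigma r c k j = sigma r c k j'"
        by (cases "k < c"; simp)+
      moreover have "inner n = zimin_cut (r + 2) ((f' \<circ> \<beta>) n) (sigma r c k n)" for n by (simp add: inner_def)
      ultimately show ?thesis
        using same_image_cut[where f = inner, OF _ g le inner_mono(1)[OF B(1,2,5)] inner_mono(1)[OF B(3,4,6)]]
          sigma_less[OF r_pos] by blast
    next
      case False
      then have "\<not> (\<beta> i' < \<beta> j' \<or> beta r k i' < beta r k j')" using d[of c] d[of k] by auto
      then have "inner i = inner j" "inner i' = inner j'" using False inner_mono B by (metis le_neq_implies_less)+
      then show ?thesis by (simp add: same_image_def)
    qed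
    have "\<gamma> i = \<gamma> i'" "\<gamma> j = \<gamma> j'"
      using gap_cong[OF m(1)] gap_cong[of j r j' c] m(1-3) by (simp, metis mod_add_left_eq)
    moreover have "\<gamma> j < r" using r_pos by (simp add: gap_def)
    ultimately show ?thesis
      using same_image_cut[OF outer_def inner inner_mono(1)[OF B(1,2,5)] inner_mono(1)[OF B(3,4,6)]
          less_imp_le[OF outer_less[OF B(1,2) True]] less_imp_le[OF outer_less[OF B(3,4) m(4)]]] by blast
  qed
  then show ?thesis unfolding realizes_def using outer_less by (auto intro: strict_mono_onI)
qed

end

end

text \<open>The two claims go together: the induction step builds realizations from those of the
  contracted system, which must exist, and recovers first the letters of the blocks from the
  contracted claim, then the letters of the word column by column.\<close>

theorem transfer:
  assumes "interval_system r X B I s e"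
  shows "(\<exists>f. realizes B I f) \<and>
    (\<forall>v. (\<forall>(a, b)\<in>set v. \<exists>x. (a, b, x) \<in> I) \<longrightarrow>
      (\<forall>f. realizes B I f \<longrightarrow> track (\<lambda>x y. zimin_inf x = zimin_inf y) f v (f s) (f e)) \<longrightarrow>
      track (\<lambda>x y. rword r x = rword r y) (\<lambda>x. x) v s e)"
  using assms
proof (induction "e - s" arbitrary: B I s e rule: less_induct)
  case less
  note S = less.prems
  have se: "s \<in> B" "e \<in> B" "B \<subseteq> {s..e}" using S unfolding interval_system_def by auto
  show ?case
  proof (cases "s < e")
    case False
    then have B: "B = {s}" "e = s" using se by auto
    have I: "i = s \<and> j = s" if "(i, j, x) \<in> I" for i j x
      using S that B unfolding interval_system_def by blast
    have "realizes B I (\<lambda>x. x)"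
      unfolding realizes_def
    proof (intro conjI allI impI)
      show "same_image (\<lambda>x. x) i j i' j'" if "(i, j, x) \<in> I" "(i', j', x) \<in> I" for i j i' j' x
        using I[OF that(1)] I[OF that(2)] by (simp add: same_image_def)
    qed (auto intro: strict_mono_onI)
    moreover have "track (\<lambda>x y. rword r x = rword r y) (\<lambda>x. x) v s e" if "\<forall>(a, b)\<in>set v. \<exists>x. (a, b, x) \<in> I" for v
      using that
    proof (induction v)
      case (Cons p v)
      obtain a b where p: "p = (a, b)" by (cases p)
      then have "a = s \<and> b = s" using Cons.prems I by auto
      then show ?case using Cons p by simp
    qed (simp add: B)
    ultimately show ?thesis by blast
  next
    case True
    obtain c where c: "Suc c < r" and gap: "\<And>n. n \<in> B \<Longrightarrow> gap r c n \<noteq> 0"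
      using interval_system_column[OF S] by blast
    let ?\<beta> = "beta r c"
    let ?I = "(\<lambda>(i, j, x). (?\<beta> i, ?\<beta> j, x)) ` I"
    note IH = less.hyps[OF beta_length_less[OF S c gap True] interval_system_beta[OF S c gap]]
    have r: "0 < r" "c < r" using c by auto
    obtain f' where f': "realizes (?\<beta> ` B) ?I f'" using IH by blast
    have "realizes B I (outer r c k f')" if "k < r" "realizes (?\<beta> ` B) ?I f'" for k f'
      by (rule realizes_outer[OF S c gap that])
    note outer = this
    have "track (\<lambda>x y. rword r x = rword r y) (\<lambda>x. x) v s e"
      if v: "\<forall>(a, b)\<in>set v. \<exists>x. (a, b, x) \<in> I"
        and T: "\<forall>f. realizes B I f \<longrightarrow> track (\<lambda>x y. zimin_inf x = zimin_inf y) f v (f s) (f e)" for v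
    proof -
      have vB: "a \<in> B \<and> b \<in> B \<and> a \<le> b" if "(a, b) \<in> set v" for a b
        using v that intervalD[OF S c gap] by fast
      \<comment> \<open>A realization built from \<open>f'\<close> and \<open>k\<close> is decoded
        in two layers: the outer one yields the columns, the inner one the codes at \<open>k\<close>
        and a track for \<open>f'\<close>.\<close>
      have tr: "itrack (\<lambda>x. x) (gap r c) v (gap r c s) (gap r c e) \<and>
          itrack (inner r c k f') (sigma r c k) v (sigma r c k s) (sigma r c k e) \<and>
          track (\<lambda>x y. zimin_inf x = zimin_inf y) (f' \<circ> ?\<beta>) v (f' (?\<beta> s)) (f' (?\<beta> e))"
        if k: "k < r" and f': "realizes (?\<beta> ` B) ?I f'" for k f'
      proof -
        note mono = inner_mono[OF S c gap k f'] and less = outer_less[OF S c gap k f']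
        let ?f = "outer r c k f'" and ?g = "inner r c k f'"
        have outer_eq: "zimin_cut r (?g s) (gap r c s) = ?f s"
          and inner_eq: "zimin_cut (r + 2) (f' (?\<beta> s)) (sigma r c k s) = ?g s"
          using outer_def[OF S c gap k f'] inner_def[OF S c gap k f'] by simp_all
        have 1: "track (\<lambda>x y. zimin_inf x = zimin_inf y) ?g v (?g s) (?g e) \<and>
            itrack ?f (gap r c) v (gap r c s) (gap r c e)"
        proof (rule track_cut[where B = B and K = r])
          show "?f n = zimin_cut r (?g n) (gap r c n)" for n by (rule outer_def[OF S c gap k f'])
          show "gap r c n < r" "gap r c s < r" for n using r by (simp_all add: gap_def)
          show "a \<in> B \<and> b \<in> B \<and> ?g a \<le> ?g b \<and> ?f a \<le> ?f b" if "(a, b) \<in> set v" for a b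
            using vB[OF that] mono(1)[of a b] less[of a b] by (cases "a = b") (auto simp: less_imp_le)
          show "e \<in> B" by (rule se)
          show "track (\<lambda>x y. zimin_inf x = zimin_inf y) ?f v (zimin_cut r (?g s) (gap r c s)) (?f e)"
            using T[rule_format, OF outer[OF k f']] by (simp only: outer_eq)
        qed
        have 2: "track (\<lambda>x y. zimin_inf x = zimin_inf y) (f' \<circ> ?\<beta>) v (f' (?\<beta> s)) ((f' \<circ> ?\<beta>) e) \<and>
            itrack ?g (sigma r c k) v (sigma r c k s) (sigma r c k e)"
        proof (rule track_cut[where B = B and K = "r + 2"])
          show "?g n = zimin_cut (r + 2) ((f' \<circ> ?\<beta>) n) (sigma r c k n)" for n
            by (simp add: inner_def[OF S c gap k f'])
          show "sigma r c k n < r + 2" "sigma r c k s < r + 2" for n using sigma_less[OF r(1)] by auto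
          show "a \<in> B \<and> b \<in> B \<and> (f' \<circ> ?\<beta>) a \<le> (f' \<circ> ?\<beta>) b \<and> ?g a \<le> ?g b" if "(a, b) \<in> set v" for a b
            using vB[OF that] mono(1)[of a b] f'_mono[OF S c gap k f', of a b] beta_mono[of a b r c]
            by (auto simp: le_less)
          show "e \<in> B" by (rule se)
          show "track (\<lambda>x y. zimin_inf x = zimin_inf y) ?g v (zimin_cut (r + 2) (f' (?\<beta> s)) (sigma r c k s)) (?g e)"
            using conjunct1[OF 1] by (simp only: inner_eq)
        qed
        have "itrack ?f (gap r c) v (gap r c s) (gap r c e) = itrack (\<lambda>x. x) (gap r c) v (gap r c s) (gap r c e)"
        proof (rule itrack_cong)
          show "?f a < ?f b \<longleftrightarrow> a < b" if "(a, b) \<in> set v" for a b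
            using vB[OF that] less[of a b] by (cases "a = b") auto
        qed
        then show ?thesis using 1 2 by simp
      qed
      have "track (\<lambda>x y. rword r x = rword r y) (\<lambda>x. x) (map (map_prod ?\<beta> ?\<beta>) v) (?\<beta> s) (?\<beta> e)"
      proof (rule IH[THEN conjunct2, rule_format])
        fix p assume "p \<in> set (map (map_prod ?\<beta> ?\<beta>) v)"
        then obtain a b where "(a, b) \<in> set v" "p = (?\<beta> a, ?\<beta> b)" by auto
        moreover from this obtain x where "(a, b, x) \<in> I" using v by blast
        ultimately show "case p of (a, b) \<Rightarrow> \<exists>x. (a, b, x) \<in> ?I" by force
      next
        \<comment> \<open>Every realization of the contracted system is the core of one for
          \<open>B\<close>, here with column \<open>0\<close>, so its track is among those
          decoded.\<close>
        fix f assume "realizes (?\<beta> ` B) ?I f"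
        then show "track (\<lambda>x y. zimin_inf x = zimin_inf y) f (map (map_prod ?\<beta> ?\<beta>) v) (f (?\<beta> s)) (f (?\<beta> e))"
          using tr[OF r(1)] unfolding track_comp by blast
      qed
      then have blocks: "track (\<lambda>x y. rword r x = rword r y) ?\<beta> v (?\<beta> s) (?\<beta> e)"
        unfolding track_comp[symmetric] by (simp add: comp_def)
      \<comment> \<open>The codes of one realization show a single column, so each \<open>k\<close>
        gets its own, all built on the same \<open>f'\<close>.\<close>
      have "track (\<lambda>x y. \<forall>k<r. x mod r = k \<longrightarrow> rword r x = rword r y) (\<lambda>x. x) v s e"
      proof (rule track_all[OF _ r(1)])
        fix k assume k: "k < r"
        show "track (\<lambda>x y. x mod r = k \<longrightarrow> rword r x = rword r y) (\<lambda>x. x) v s e"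
          by (rule track_letters[where c = c and f = "inner r c k f'", OF r(2) k])
            (use vB inner_mono(2)[OF S c gap k f'] tr[OF k f'] blocks in auto)
      qed
      then show ?thesis by (rule track_mono) (use r in auto)
    qed
    then show ?thesis using outer[OF r(1) f'] by blast
  qed
qed

section \<open>Inherent nonfinite basis\<close>

definition L_fin :: "nat \<Rightarrow> (nat \<times> nat) list set" where
  "L_fin r = {map (rword r) [i..<j] | i j. i < j}"

lemma L_fin_nonempty: "[] \<notin> L_fin r"
  by (auto simp: L_fin_def)

lemma L_fin_factor:
  assumes "p @ w @ q \<in> L_fin r" "w \<noteq> []"
  shows "w \<in> L_fin r"
proof -
  from assms(1) obtain i j where e: "p @ w @ q = map (rword r) [i..<j]"
    by (auto simp: L_fin_def)
  have l: "length p + length w + length q = j - i"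
    using arg_cong[OF e, of length] by simp
  have "w = take (length w) (drop (length p) (p @ w @ q))" by simp
  also have "\<dots> = map (rword r) [i + length p..<i + length p + length w]"
    unfolding e using l by (cases "i \<le> j") (auto simp: take_map drop_map take_upt)
  finally show ?thesis using assms(2) unfolding L_fin_def by fastforce
qed

text \<open>The factorizations of the common image by the words of \<open>s\<close> form an interval
  system labelled by variables. Each realization is a substitution into \<open>L_inf\<close>, to
  which the identity applies, so \<open>v\<close> has the right image under all of them;
  \<open>transfer\<close> carries this to \<open>rword r\<close>.\<close>

lemma F_inf_identity_transfer:
  fixes s t :: "nat trm"
  defines "X \<equiv> \<Union> (set ` words s)"
  assumes st: "satisfies F_inf (s, t)" and r: "card (set_trm s) + 3 \<le> r"
    and h: "\<And>x. x \<in> X \<Longrightarrow> h x \<noteq> []" and se: "s0 < e0"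
    and u: "\<And>u. u \<in> words s \<Longrightarrow> concat (map h u) = map (rword r) [s0..<e0]"
    and v: "v \<in> words t"
  shows "set v \<subseteq> X \<and> concat (map h v) = map (rword r) [s0..<e0]"
proof -
  define bd where "bd u m = s0 + length (concat (map h (take m u)))" for u :: "nat list" and m
  define B where "B = {bd u m | u m. u \<in> words s \<and> m \<le> length u}"
  define I where "I = {(bd u m, bd u (Suc m), u ! m) | u m. u \<in> words s \<and> m < length u}"
  have in_I: "(bd u m, bd u (Suc m), u ! m) \<in> I" if "u \<in> words s" "m < length u" for u m
    unfolding I_def using that by blast
  have in_B: "bd u m \<in> B" if "u \<in> words s" "m \<le> length u" for u m
    unfolding B_def using that by blast
  have bd0: "bd u 0 = s0" for u by (simp add: bd_def)
  have bd_end: "bd u (length u) = e0" if "u \<in> words s" for u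
    using u[OF that] se by (simp add: bd_def)
  have bd_Suc: "bd u (Suc m) = bd u m + length (h (u ! m))" if "m < length u" for u m
    using that by (simp add: bd_def take_Suc_conv_app_nth)
  have bd_le: "bd u m \<le> e0" if "u \<in> words s" for u m
  proof -
    have "concat (map h u) = concat (map h (take m u)) @ concat (map h (drop m u))"
      by (metis append_take_drop_id concat_append map_append)
    from arg_cong[OF this, of length] show ?thesis using u[OF that] se by (simp add: bd_def)
  qed
  have I_word: "h x = map (rword r) [i..<j] \<and> i < j" if "(i, j, x) \<in> I" for i j x
  proof -
    obtain u' m where m: "u' \<in> words s" "m < length u'" "i = bd u' m" "j = bd u' (Suc m)" "x = u' ! m"
      using \<open>(i, j, x) \<in> I\<close> by (auto simp: I_def)
    let ?p = "concat (map h (take m u'))"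
    have "u' = take m u' @ x # drop (Suc m) u'" using m by (simp add: id_take_nth_drop)
    then have "concat (map h u') = ?p @ h x @ concat (map h (drop (Suc m) u'))"
      by (metis concat.simps(2) concat_append list.simps(9) map_append)
    then have e: "?p @ h x @ concat (map h (drop (Suc m) u')) = map (rword r) [s0..<e0]"
      using u[OF m(1)] by simp
    have j: "j = i + length (h x)" using bd_Suc[OF m(2)] m by simp
    have "h x = take (length (h x)) (drop (length ?p) (?p @ h x @ concat (map h (drop (Suc m) u'))))"
      by simp
    also have "\<dots> = map (rword r) [i..<j]"
      unfolding e using j bd_le[OF m(1), of "Suc m"] m(3,4)
      by (simp add: take_map drop_map take_upt bd_def add.assoc)
    finally have "h x = map (rword r) [i..<j]" .
    moreover have "x \<in> X"
    proof -
      have "x \<in> set u'" using m by simp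
      then show ?thesis using m(1) unfolding X_def by blast
    qed
    then have "i < j" using h j by fastforce
    ultimately show ?thesis by blast
  qed
  have used: "\<exists>i j. (i, j, x) \<in> I" if x: "x \<in> X" for x
  proof -
    obtain u' where u': "u' \<in> words s" "x \<in> set u'" using x unfolding X_def by blast
    then obtain m where "m < length u'" "x = u' ! m" by (auto simp: in_set_conv_nth)
    then show ?thesis using in_I u'(1) by blast
  qed
  have X: "X \<subseteq> set_trm s" using set_words unfolding X_def by fast
  have S: "interval_system r X B I s0 e0"
    unfolding interval_system_def
  proof (intro conjI allI impI ballI)
    show "finite X" using X finite_set_trm finite_subset by blast
    show "card X + 3 \<le> r" using card_mono[OF finite_set_trm X] r by simp
    obtain u' where "u' \<in> words s" using words_nonempty by blast
    then show "s0 \<in> B" "e0 \<in> B" using in_B[of u' 0] in_B[of u' "length u'"] bd0 bd_end by simp_all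
    show "B \<subseteq> {s0..e0}" unfolding B_def using bd_le by (auto simp: bd_def)
  next
    fix i j x assume ij: "(i, j, x) \<in> I"
    then obtain u' m where m: "u' \<in> words s" "m < length u'" "i = bd u' m" "j = bd u' (Suc m)" "x = u' ! m"
      by (auto simp: I_def)
    then show "i \<in> B" "j \<in> B" using in_B by simp_all
    have "x \<in> set u'" using m by simp
    then show "x \<in> X" using m(1) unfolding X_def by blast
    show "i \<le> j" using I_word[OF ij] by simp
  next
    fix i j i' j' x assume ij: "(i, j, x) \<in> I" "(i', j', x) \<in> I"
    have e: "map (rword r) [i..<j] = map (rword r) [i'..<j']"
      using I_word[OF ij(1)] I_word[OF ij(2)] by metis
    show *: "j - i = j' - i'" using arg_cong[OF e, of length] by simp
    show "rword r (i + t) = rword r (i' + t)" if "t < j - i" for t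
      using arg_cong[OF e, of "\<lambda>w. w ! t"] that * by simp
  next
    fix n assume "n \<in> B" "n < e0"
    then obtain u' m where m: "u' \<in> words s" "m \<le> length u'" "n = bd u' m" by (auto simp: B_def)
    then have "m \<noteq> length u'" using bd_end \<open>n < e0\<close> by auto
    then have "(n, bd u' (Suc m), u' ! m) \<in> I" using m in_I by simp
    then show "\<exists>j x. (n, j, x) \<in> I \<and> n < j" using I_word by blast
  qed
  note tr = transfer[OF S]
  \<comment> \<open>Any occurrence of \<open>x\<close> may represent it: a realization gives all of
    them the same image.\<close>
  define rep where "rep x = (SOME p. (fst p, snd p, x) \<in> I)" for x
  have rep: "(fst (rep x), snd (rep x), x) \<in> I" if x: "x \<in> X" for x
  proof -
    obtain i j where "(i, j, x) \<in> I" using used[OF x] by blast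
    then have "(fst (i, j), snd (i, j), x) \<in> I" by simp
    then show ?thesis unfolding rep_def by (rule someI)
  qed
  have se_B: "s0 \<in> B" "e0 \<in> B" and IB: "\<And>i j x. (i, j, x) \<in> I \<Longrightarrow> i \<in> B \<and> j \<in> B"
    using S unfolding interval_system_def by blast+
  have key: "set v \<subseteq> X \<and> concat (map (\<lambda>x. map zimin_inf [f (fst (rep x))..<f (snd (rep x))]) v) =
      map zimin_inf [f s0..<f e0]" if f: "realizes B I f" for f
  proof -
    have mono: "f i < f j" if "i \<in> B" "j \<in> B" "i < j" for i j
      using f that unfolding realizes_def by (auto dest: strict_mono_onD)
    have mono_le: "f i \<le> f j" if "i \<in> B" "j \<in> B" "i \<le> j" for i j
      using mono[OF that(1,2)] that(3) by (cases "i = j") (simp_all add: less_imp_le)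
    let ?W = "map zimin_inf [f s0..<f e0]" and ?\<phi> = "\<lambda>x. map zimin_inf [f (fst (rep x))..<f (snd (rep x))]"
    \<comment> \<open>A letter outside the common image, and nonzero to keep \<open>[M]\<close> in
      \<open>L_inf\<close>; as the image of all variables outside \<open>X\<close> it shows that
      \<open>v\<close> contains none of them.\<close>
    obtain M where M: "M \<notin> insert 0 (set ?W)"
      using ex_new_if_finite[of "insert 0 (set ?W)"] infinite_UNIV_nat by blast
    define \<psi> where "\<psi> x = (if x \<in> X then ?\<phi> x else [M])" for x
    have \<psi>_I: "\<psi> x = map zimin_inf [f i..<f j]" if ij: "(i, j, x) \<in> I" for i j x
    proof -
      have x: "x \<in> X" using S ij unfolding interval_system_def by blast
      have "same_image f i j (fst (rep x)) (snd (rep x))"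
        using f ij rep[OF x] unfolding realizes_def by blast
      then have "map zimin_inf [f i..<f j] = ?\<phi> x"
        unfolding same_image_def by (intro nth_equalityI) auto
      then show ?thesis using x by (simp add: \<psi>_def)
    qed
    have W: "concat (map \<psi> u') = ?W" if u': "u' \<in> words s" for u'
    proof -
      have "concat (map \<psi> (take m u')) = map zimin_inf [f s0..<f (bd u' m)]" if "m \<le> length u'" for m
        using that
      proof (induction m)
        case (Suc m)
        have I: "(bd u' m, bd u' (Suc m), u' ! m) \<in> I" using in_I u' Suc.prems by simp
        have "s0 \<le> bd u' m" by (simp add: bd_def)
        then have "f s0 \<le> f (bd u' m)" using mono_le[OF se_B(1)] IB[OF I] by blast
        moreover have "f (bd u' m) \<le> f (bd u' (Suc m))"
          using mono_le IB[OF I] I_word[OF I] less_imp_le by blast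
        ultimately have "[f s0..<f (bd u' (Suc m))] = [f s0..<f (bd u' m)] @ [f (bd u' m)..<f (bd u' (Suc m))]"
          using upt_add_eq_append[of "f s0" "f (bd u' m)" "f (bd u' (Suc m)) - f (bd u' m)"] by simp
        then show ?case using Suc \<psi>_I[OF I] by (simp add: take_Suc_conv_app_nth)
      qed (simp add: bd0)
      from this[of "length u'"] show ?thesis using bd_end[OF u'] by simp
    qed
    have \<psi>: "\<psi> x \<in> L_inf" for x
    proof (cases "x \<in> X")
      case True
      then have "f (fst (rep x)) < f (snd (rep x))" using rep IB I_word mono by blast
      then show ?thesis using True unfolding \<psi>_def L_inf_def by auto
    next
      case False
      then show ?thesis using singleton_in_L_inf[of M] M by (simp add: \<psi>_def)
    qed
    have "?W \<in> L_inf" using mono[OF se_B se] unfolding L_inf_def by blast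
    then have e: "concat (map \<psi> v) = ?W"
      using satisfies_F_inf_substitution[OF st \<psi> _ W v] by blast
    have vX: "set v \<subseteq> X"
    proof
      fix x assume x: "x \<in> set v"
      show "x \<in> X"
      proof (rule ccontr)
        assume "x \<notin> X"
        then have "M \<in> set (concat (map \<psi> v))" using x by (auto simp: \<psi>_def intro!: bexI[of _ x])
        then show False unfolding e using M by simp
      qed
    qed
    then have "map \<psi> v = map ?\<phi> v" by (auto simp: \<psi>_def)
    with e have "concat (map ?\<phi> v) = ?W" by (simp only:)
    with vX show ?thesis by blast
  qed
  obtain f where "realizes B I f" using tr by blast
  then have vX: "set v \<subseteq> X" using key by blast
  have rep_v: "(a, b, x) \<in> I \<and> x \<in> X" if "x \<in> set v" "rep x = (a, b)" for a b x
    using rep[of x] that vX by auto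
  have "track (\<lambda>x y. rword r x = rword r y) (\<lambda>x. x) (map rep v) s0 e0"
  proof (rule tr[THEN conjunct2, rule_format])
    fix p assume "p \<in> set (map rep v)"
    then obtain x where "x \<in> set v" "p = rep x" by auto
    then show "case p of (a, b) \<Rightarrow> \<exists>x. (a, b, x) \<in> I" using rep_v by (cases p) auto
  next
    fix f assume f: "realizes B I f"
    have mono: "f i < f j" if "i \<in> B" "j \<in> B" "i < j" for i j
      using f that unfolding realizes_def by (auto dest: strict_mono_onD)
    have le: "f a \<le> f b" if ab: "(a, b) \<in> set (map rep v)" for a b
    proof -
      obtain x where "x \<in> set v" "rep x = (a, b)" using ab by auto
      then have "(a, b, x) \<in> I" using rep_v by blast
      then show ?thesis using mono IB I_word by (simp add: less_imp_le)
    qed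
    have "concat (map (\<lambda>(a, b). map zimin_inf [f a..<f b]) (map rep v)) = map zimin_inf [f s0..<f e0]"
      using key[OF f] by (simp add: comp_def case_prod_beta)
    then show "track (\<lambda>x y. zimin_inf x = zimin_inf y) f (map rep v) (f s0) (f e0)"
      using track_word[of "map rep v" f "f s0" "f e0" zimin_inf, OF le] mono[OF se_B se] by simp
  qed
  moreover have "a \<le> b" if ab: "(a, b) \<in> set (map rep v)" for a b
  proof -
    obtain x where "x \<in> set v" "rep x = (a, b)" using ab by auto
    then show ?thesis using rep_v I_word by (meson less_imp_le)
  qed
  ultimately have "concat (map (\<lambda>(a, b). map (rword r) [a..<b]) (map rep v)) = map (rword r) [s0..<e0]"
    using track_word[of "map rep v" "\<lambda>x. x" s0 e0 "rword r"] se by simp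
  moreover have "map (\<lambda>(a, b). map (rword r) [a..<b]) (map rep v) = map h v"
  proof -
    have "h x = map (rword r) [fst (rep x)..<snd (rep x)]" if "x \<in> set v" for x
      using rep I_word vX that by blast
    then show ?thesis by (simp add: case_prod_beta)
  qed
  ultimately have "concat (map h v) = map (rword r) [s0..<e0]" by (simp only:)
  with vX show ?thesis by blast
qed

lemma satisfies_flat_L_fin:
  assumes "satisfies F_inf (s0, t0)" "card (set_trm s0) + 3 \<le> r" "card (set_trm t0) + 3 \<le> r"
  shows "satisfies (flat (L_fin r)) (s0, t0)"
proof (rule satisfies_flatI)
  fix h w s t
  assume h: "range h \<subseteq> carrier (flat (L_fin r))" and st: "{s, t} = {s0, t0}"
    and s: "eval (flat (L_fin r)) h s = Some w"
  have iff: "eval (flat (L_fin r)) h t = Some w \<longleftrightarrow> w \<in> L_fin r \<and>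
      (\<forall>u\<in>words t. (\<forall>x\<in>set u. h x \<noteq> None) \<and> concat (map (the \<circ> h) u) = w)" for t w
    using eval_flat_eq_Some_iff[of "L_fin r" h] L_fin_factor L_fin_nonempty h by blast
  note s = s[unfolded iff]
  have F: "satisfies F_inf (s, t)" "card (set_trm s) + 3 \<le> r"
    using assms st satisfies_sym by (auto simp: doubleton_eq_iff)
  obtain i j where w: "w = map (rword r) [i..<j]" "i < j" using s by (auto simp: L_fin_def)
  let ?X = "\<Union> (set ` words s)"
  have hX: "h x \<noteq> None" if "x \<in> ?X" for x using s that by blast
  have ne: "(the \<circ> h) x \<noteq> []" if "x \<in> ?X" for x
  proof -
    have "h x \<in> carrier (flat (L_fin r))" using h by auto
    then show ?thesis using hX[OF that] L_fin_nonempty by (auto simp: flat_def)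
  qed
  have "set v \<subseteq> ?X \<and> concat (map (the \<circ> h) v) = w" if "v \<in> words t" for v
  proof -
    have "concat (map (the \<circ> h) u) = map (rword r) [i..<j]" if "u \<in> words s" for u
      using s that unfolding w(1)[symmetric] by blast
    then show ?thesis
      unfolding w(1) by (intro F_inf_identity_transfer[OF F ne w(2) _ that]) blast
  qed
  then show "eval (flat (L_fin r)) h t = Some w" unfolding iff using s hX by blast
qed (use L_fin_factor L_fin_nonempty in blast)+

section \<open>A finitely generated infinite algebra\<close>

lemma finite_range_rword: "0 < r \<Longrightarrow> finite (range (rword r))"
  by (rule finite_subset[of _ "{..<r} \<times> {..<r}"]) (auto simp: rword_def rval_less)

text \<open>Factors are built letter by letter, and zero is the sum of two different letters, which
  exist for \<open>2 \<le> r\<close>.\<close>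

lemma finitely_generated_flat_L_fin:
  assumes "2 \<le> r"
  shows "finitely_generated (flat (L_fin r))"
proof -
  let ?A = "flat (L_fin r)"
  let ?X = "(\<lambda>l. Some [l]) ` range (rword r)"
  have letter: "[rword r n] \<in> L_fin r" for n
  proof -
    have "map (rword r) [n..<Suc n] \<in> L_fin r" unfolding L_fin_def by blast
    then show ?thesis by simp
  qed
  have "carrier ?A \<subseteq> C" if C: "subuniverse ?A C" "?X \<subseteq> C" for C
  proof -
    have "Some (map (rword r) [i..<Suc i + d]) \<in> C" for i d
    proof (induction d)
      case 0
      have "Some [rword r i] \<in> C" using C(2) by blast
      then show ?case by simp
    next
      case (Suc d)
      let ?w = "map (rword r) [i..<Suc i + d]" and ?l = "[rword r (Suc i + d)]"
      have "Some ?l \<in> C" using C(2) by blast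
      then have "mul ?A (Some ?w) (Some ?l) \<in> C" using Suc C(1) unfolding subuniverse_def by blast
      moreover have e: "?w @ ?l = map (rword r) [i..<Suc i + Suc d]" by simp
      moreover have "map (rword r) [i..<Suc i + n] \<in> L_fin r" for n
      proof -
        have "i < Suc i + n" by simp
        then show ?thesis unfolding L_fin_def by blast
      qed
      then have "?w \<in> L_fin r" "?w @ ?l \<in> L_fin r" unfolding e by blast+
      moreover have "mul ?A (Some p) (Some q) = Some (p @ q)"
        if "p \<in> L_fin r" "q \<in> L_fin r" "p @ q \<in> L_fin r" for p q
        using that by (simp add: flat_def)
      ultimately show ?case using letter by metis
    qed
    note words = this
    have "Some w \<in> C" if w: "w \<in> L_fin r" for w
    proof -
      obtain i j where "w = map (rword r) [i..<j]" "i < j" using w by (auto simp: L_fin_def)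
      then show ?thesis using words[of i "j - Suc i"] by simp
    qed
    moreover have "None \<in> C"
    proof -
      have "Some [rword r 0] \<in> C" "Some [rword r 1] \<in> C" using C(2) by blast+
      then have "add ?A (Some [rword r 0]) (Some [rword r 1]) \<in> C"
        using C(1) unfolding subuniverse_def by blast
      moreover have "rword r 0 \<noteq> rword r 1" using assms by (simp add: rword_def)
      ultimately show ?thesis by (simp add: flat_def)
    qed
    ultimately show ?thesis by (auto simp: flat_def)
  qed
  moreover have "subuniverse ?A (carrier ?A)"
    by (auto simp: subuniverse_def flat_def split: option.splits)
  moreover have X: "?X \<subseteq> carrier ?A" using letter by (auto simp: flat_def)
  ultimately have "generated ?A ?X = carrier ?A" unfolding generated_def by blast
  moreover have "finite ?X" using finite_range_rword[of r] assms by simp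
  ultimately show ?thesis unfolding finitely_generated_def using X by blast
qed

lemma infinite_carrier_flat_L_fin: "infinite (carrier (flat (L_fin r)))"
proof
  assume fin: "finite (carrier (flat (L_fin r)))"
  have "map (rword r) [0..<Suc n] \<in> L_fin r" for n
    unfolding L_fin_def using zero_less_Suc by blast
  then have "range (\<lambda>n. Some (map (rword r) [0..<Suc n])) \<subseteq> carrier (flat (L_fin r))"
    by (intro image_subsetI) (simp only: mem_carrier_flat)
  then have "finite (range (\<lambda>n. Some (map (rword r) [0..<Suc n])))" using fin finite_subset by blast
  moreover have "inj (\<lambda>n. Some (map (rword r) [0..<Suc n]))"
  proof (rule injI)
    fix m n assume "Some (map (rword r) [0..<Suc m]) = Some (map (rword r) [0..<Suc n])"
    then have "length (map (rword r) [0..<Suc m]) = length (map (rword r) [0..<Suc n])"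
      by (metis option.inject)
    then show "m = n" by simp
  qed
  ultimately show False using finite_imageD infinite_UNIV_nat by blast
qed

lemma ex_inj_infinite:
  obtains f :: "'a::countable \<Rightarrow> 'u::infinite" where "inj f"
proof -
  obtain g :: "nat \<Rightarrow> 'u" where "inj g"
    using infinite_countable_subset[OF infinite_UNIV] by blast
  then have "inj (g \<circ> (to_nat :: 'a \<Rightarrow> nat))" by (intro inj_compose) auto
  then show thesis by (rule that)
qed

text \<open>A finite basis \<open>E\<close> bounds the number of variables, so for large
  \<open>r\<close> the semiring \<open>flat (L_fin r)\<close> satisfies it. This semiring is
  infinite and finitely generated, which contradicts local finiteness.\<close>

lemma inherently_nonfinitely_based_variety_of_F_inf:
  "inherently_nonfinitely_based (variety_of F_inf :: 'u::infinite alg set)"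
  unfolding inherently_nonfinitely_based_def
proof (intro conjI notI)
  show "variety (variety_of F_inf :: 'u alg set)" by (rule variety_variety_of[OF algebra_F_inf])
  show "locally_finite (variety_of F_inf :: 'u alg set)" by (rule locally_finite_variety_of_F_inf)
  assume "\<exists>W :: 'u alg set. variety W \<and> finitely_based W \<and> locally_finite W \<and> variety_of F_inf \<subseteq> W"
  then obtain W :: "'u alg set" and E where E: "finite E" "W = models E"
    and W: "locally_finite W" "variety_of F_inf \<subseteq> W"
    by (auto simp: finitely_based_def)
  obtain f :: "nat list option \<Rightarrow> 'u" where f: "inj f" by (rule ex_inj_infinite)
  have "copy_alg f F_inf \<in> variety_of F_inf"
    unfolding mem_variety_of_iff[OF algebra_F_inf]
    using algebra_copy_alg[OF f algebra_F_inf] satisfies_copy_alg[OF f] by blast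
  then have F: "satisfies F_inf e" if "e \<in> E" for e
    using that W(2) E(2) satisfies_copy_alg[OF f, of F_inf e] unfolding models_def by blast
  \<comment> \<open>The sum bounds the number of variables on each side of every identity of
    \<open>E\<close>; the \<open>3\<close> is the margin required by
    \<open>interval_system\<close>.\<close>
  define r where "r = (\<Sum>(s, t)\<in>E. card (set_trm s) + card (set_trm t)) + 3"
  have "satisfies (flat (L_fin r)) e" if e: "e \<in> E" for e
  proof -
    obtain s t where st: "e = (s, t)" by (cases e)
    have "(case e of (s, t) \<Rightarrow> card (set_trm s) + card (set_trm t)) \<le>
        (\<Sum>(s, t)\<in>E. card (set_trm s) + card (set_trm t))"
      by (rule member_le_sum[OF e _ E(1)]) simp
    then show ?thesis using satisfies_flat_L_fin F[OF e] unfolding st r_def by simp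
  qed
  moreover have alg: "algebra (flat (L_fin r))"
    using ai_semiring_flat[of "L_fin r"] L_fin_factor L_fin_nonempty by (auto simp: ai_semiring_def)
  moreover obtain g :: "(nat \<times> nat) list option \<Rightarrow> 'u" where g: "inj g" by (rule ex_inj_infinite)
  ultimately have "copy_alg g (flat (L_fin r)) \<in> W"
    unfolding E(2) models_def using algebra_copy_alg[OF g] satisfies_copy_alg[OF g] by blast
  moreover have "finitely_generated (copy_alg g (flat (L_fin r)))"
    by (rule finitely_generated_copy_alg[OF g alg finitely_generated_flat_L_fin]) (simp add: r_def)
  ultimately have "finite (carrier (copy_alg g (flat (L_fin r))))"
    using W(1) by (simp add: locally_finite_def)
  then have "finite (carrier (flat (L_fin r)))"
    using finite_imageD[of g] inj_on_subset[OF g] by (auto simp: copy_alg_simps[OF g])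
  then show False using infinite_carrier_flat_L_fin by blast
qed

theorem theorem1p2:
  "(\<forall>S :: 's alg. ai_semiring S \<longrightarrow>
      ((\<forall>m\<ge>1. minimal_for (zimin m) S) \<longleftrightarrow> F_inf \<in> variety_of S)) \<and>
   locally_finite (variety_of F_inf :: 'u::infinite alg set) \<and>
   inherently_nonfinitely_based (variety_of F_inf :: 'u::infinite alg set) \<and>
   brandt_semiring \<notin> variety_of F_inf"
  using F_inf_in_variety_imp_minimal minimal_imp_F_inf_in_variety locally_finite_variety_of_F_inf
    inherently_nonfinitely_based_variety_of_F_inf brandt_not_in_variety_of_F_inf by blast

end
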